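(* Let $(\mathcal{A},\varphi,\varphi^\prime)$ be an infinitesimal non-commutative probability space, with free, Boolean and monotone cumulants $r_n,b_n,h_n$ and infinitesimal free, Boolean and monotone cumulants $r^\prime_n,b^\prime_n,h^\prime_n$. Then for every $n\ge 1$ and all $a_1,\dots,a_n\in\mathcal{A}$: \begin{align*} b^\prime_n (a_1, \dots, a_n) &= \sum_{\pi\in \mathcal{NC}_{irr}(n)} \partial r_\pi(a_1, \dots, a_n),\\ r^\prime_n (a_1, \dots, a_n) &= \sum_{\pi\in \mathcal{NC}_{irr}(n)} (-1)^{|\pi|-1} \partial b_\pi(a_1, \dots, a_n),\\ b^\prime_n (a_1, \dots, a_n) &= \sum_{\pi\in \mathcal{NC}_{irr}(n)} \frac{1}{\tau(\pi)!}\partial h_\pi(a_1, \dots, a_n),\\ r^\prime_n (a_1, \dots, a_n) &= \sum_{\pi\in \mathcal{NC}_{irr}(n)} \frac{(-1)^{|\pi|-1}}{\tau(\pi)!} \partial h_\pi(a_1, \dots, a_n). \end{align*}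
   Context: An infinitesimal non-commutative probability space is a triple $(\mathcal{A},\varphi,\varphi^\prime)$ where $\mathcal{A}$ is a unital complex algebra and $\varphi,\varphi^\prime:\mathcal{A}\to\mathbb{C}$ are linear with $\varphi(1_\mathcal{A})=1$, $\varphi^\prime(1_\mathcal{A})=0$. Write $\varphi_n(a_1,\dots,a_n)=\varphi(a_1\cdots a_n)$ and $\varphi^\prime_n(a_1,\dots,a_n)=\varphi^\prime(a_1\cdots a_n)$. Partitions: $\mathcal{P}(n)$ is the set of partitions of $[n]=\{1,\dots,n\}$, $\mathcal{NC}(n)$ the non-crossing ones, $\mathcal{I}(n)$ the interval partitions (all blocks are intervals), and $\mathcal{NC}_{irr}(n)$ the non-crossing partitions in which $1$ and $n$ lie in the same block. $|\pi|$ is the number of blocks. For $\pi\in\mathcal{NC}(n)$ and a block $V$, let $N(V)$ be the number of blocks $W\in\pi$ with $W\subseteq\{\min V,\min V+1,\dots,\max V\}$ (including $V$), and $\tau(\pi)!:=\prod_{V\in\pi}N(V)$. For a family of multilinear maps $f_m:\mathcal{A}^m\to\mathbb{C}$ and $\pi\in\mathcal{P}(n)$, $f_\pi(a_1,\dots,a_n):=\prod_{V\in\pi}f_{|V|}(a_V)$, where for $V=\{v_1<\dots<v_k\}$, $f_{|V|}(a_V)=f_k(a_{v_1},\dots,a_{v_k})$. For a sequence of pairs $(f_m,f^\prime_m)$ of multilinear maps, $\partial f_\pi(a_1,\dots,a_n):=\sum_{V\in\pi} f^\prime_{|V|}(a_V)\prod_{W\in\pi,W\neq V}f_{|W|}(a_W)$.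 Cumulants are the multilinear maps defined recursively by, for all $n$ and $a_i\in\mathcal{A}$: free $\varphi_n=\sum_{\pi\in\mathcal{NC}(n)}r_\pi$; Boolean $\varphi_n=\sum_{\pi\in\mathcal{I}(n)}b_\pi$; monotone $\varphi_n=\sum_{\pi\in\mathcal{NC}(n)}\frac{1}{\tau(\pi)!}h_\pi$. Infinitesimal cumulants are defined recursively by $\varphi^\prime_n=\sum_{\pi\in\mathcal{NC}(n)}\partial r_\pi$ (free, using pairs $(r_m,r^\prime_m)$), $\varphi^\prime_n=\sum_{\pi\in\mathcal{I}(n)}\partial b_\pi$ (Boolean, pairs $(b_m,b^\prime_m)$), $\varphi^\prime_n=\sum_{\pi\in\mathcal{NC}(n)}\frac{1}{\tau(\pi)!}\partial h_\pi$ (monotone, pairs $(h_m,h^\prime_m)$), all evaluated at $(a_1,\dots,a_n)$. *)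

theory Defs
  imports Complex_Main "HOL-Library.Disjoint_Sets"
begin

section \<open>Infinitesimal non-commutative probability spaces\<close>

text \<open>The ring structure comes from the type; the complex scalar multiplication is an explicit
  parameter, since the distribution only provides type classes for real algebras.\<close>

locale complex_unital_algebra = vector_space scale
  for scale :: "complex \<Rightarrow> 'a::ring_1 \<Rightarrow> 'a" +
  assumes scale_mult_left: "scale c x * y = scale c (x * y)"
    and scale_mult_right: "x * scale c y = scale c (x * y)"

locale infinitesimal_ncps = complex_unital_algebra scale
  for scale :: "complex \<Rightarrow> 'a::ring_1 \<Rightarrow> 'a" +
  fixes \<phi> \<phi>' :: "'a \<Rightarrow> complex"
  assumes linear_phi: "Vector_Spaces.linear scale (*) \<phi>"
    and linear_phi': "Vector_Spaces.linear scale (*) \<phi>'"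
    and phi_one: "\<phi> 1 = 1"
    and phi'_one: "\<phi>' 1 = 0"


section \<open>Partitions\<close>

definition partitions :: "nat \<Rightarrow> nat set set set" where
  "partitions n = {\<pi>. partition_on {1..n} \<pi>}"

definition noncrossing :: "nat set set \<Rightarrow> bool" where
  "noncrossing \<pi> \<longleftrightarrow>
     \<not> (\<exists>V\<in>\<pi>. \<exists>W\<in>\<pi>. V \<noteq> W \<and>
          (\<exists>a b c d. a < b \<and> b < c \<and> c < d \<and> a \<in> V \<and> c \<in> V \<and> b \<in> W \<and> d \<in> W))"

definition NC :: "nat \<Rightarrow> nat set set set" where
  "NC n = {\<pi> \<in> partitions n. noncrossing \<pi>}"

definition interval_partitions :: "nat \<Rightarrow> nat set set set" where
  "interval_partitions n = {\<pi> \<in> partitions n. \<forall>V\<in>\<pi>. \<exists>i j. V = {i..j}}"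

definition NC_irr :: "nat \<Rightarrow> nat set set set" where
  "NC_irr n = {\<pi> \<in> NC n. \<exists>V\<in>\<pi>. 1 \<in> V \<and> n \<in> V}"

definition nested_blocks :: "nat set set \<Rightarrow> nat set \<Rightarrow> nat" where
  "nested_blocks \<pi> V = card {W \<in> \<pi>. W \<subseteq> {Min V..Max V}}"

definition tree_factorial :: "nat set set \<Rightarrow> nat" where
  "tree_factorial \<pi> = (\<Prod>V\<in>\<pi>. nested_blocks \<pi> V)"


section \<open>Families of multilinear functionals\<close>

text \<open>A family \<open>f\<^sub>m\<close> of maps on \<open>m\<close>-tuples, \<open>m \<ge> 1\<close>, is one function \<open>f\<close> on lists: \<open>f\<^sub>m\<close> is its
  restriction to lists of length \<open>m\<close>. The value at the empty list plays no role.\<close>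

definition multilinear_family :: "(complex \<Rightarrow> 'a::ring_1 \<Rightarrow> 'a) \<Rightarrow> ('a list \<Rightarrow> complex) \<Rightarrow> bool" where
  "multilinear_family scale f \<longleftrightarrow>
     (\<forall>xs ys. Vector_Spaces.linear scale (*) (\<lambda>x. f (xs @ x # ys)))"

text \<open>The tuple \<open>a\<^sub>V\<close>. Positions are numbered from 1, list indices from 0.\<close>

definition restrict_args :: "'a list \<Rightarrow> nat set \<Rightarrow> 'a list" where
  "restrict_args as V = map (\<lambda>i. as ! (i - 1)) (sorted_list_of_set V)"

definition part_eval :: "('a list \<Rightarrow> complex) \<Rightarrow> nat set set \<Rightarrow> 'a list \<Rightarrow> complex" where
  "part_eval f \<pi> as = (\<Prod>V\<in>\<pi>. f (restrict_args as V))"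

definition part_deriv ::
    "('a list \<Rightarrow> complex) \<Rightarrow> ('a list \<Rightarrow> complex) \<Rightarrow> nat set set \<Rightarrow> 'a list \<Rightarrow> complex" where
  "part_deriv f f' \<pi> as =
     (\<Sum>V\<in>\<pi>. f' (restrict_args as V) * (\<Prod>W\<in>\<pi> - {V}. f (restrict_args as W)))"


section \<open>Cumulants\<close>

text \<open>Each predicate says that a family is multilinear and satisfies the moment-cumulant formula.
  Since the one-block partition occurs in each formula with coefficient 1, the formula is a
  recursion which determines the family on all nonempty lists.\<close>

definition free_cumulants ::
    "(complex \<Rightarrow> 'a::ring_1 \<Rightarrow> 'a) \<Rightarrow> ('a \<Rightarrow> complex) \<Rightarrow> ('a list \<Rightarrow> complex) \<Rightarrow> bool" where
  "free_cumulants scale \<phi> r \<longleftrightarrow> multilinear_family scale r \<and>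
     (\<forall>n\<ge>1. \<forall>as. length as = n \<longrightarrow>
        \<phi> (prod_list as) = (\<Sum>\<pi>\<in>NC n. part_eval r \<pi> as))"

definition boolean_cumulants ::
    "(complex \<Rightarrow> 'a::ring_1 \<Rightarrow> 'a) \<Rightarrow> ('a \<Rightarrow> complex) \<Rightarrow> ('a list \<Rightarrow> complex) \<Rightarrow> bool" where
  "boolean_cumulants scale \<phi> b \<longleftrightarrow> multilinear_family scale b \<and>
     (\<forall>n\<ge>1. \<forall>as. length as = n \<longrightarrow>
        \<phi> (prod_list as) = (\<Sum>\<pi>\<in>interval_partitions n. part_eval b \<pi> as))"

definition monotone_cumulants ::
    "(complex \<Rightarrow> 'a::ring_1 \<Rightarrow> 'a) \<Rightarrow> ('a \<Rightarrow> complex) \<Rightarrow> ('a list \<Rightarrow> complex) \<Rightarrow> bool" where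
  "monotone_cumulants scale \<phi> h \<longleftrightarrow> multilinear_family scale h \<and>
     (\<forall>n\<ge>1. \<forall>as. length as = n \<longrightarrow>
        \<phi> (prod_list as) = (\<Sum>\<pi>\<in>NC n. 1 / of_nat (tree_factorial \<pi>) * part_eval h \<pi> as))"

definition inf_free_cumulants ::
    "(complex \<Rightarrow> 'a::ring_1 \<Rightarrow> 'a) \<Rightarrow> ('a \<Rightarrow> complex) \<Rightarrow> ('a list \<Rightarrow> complex) \<Rightarrow>
     ('a list \<Rightarrow> complex) \<Rightarrow> bool" where
  "inf_free_cumulants scale \<phi>' r r' \<longleftrightarrow> multilinear_family scale r' \<and>
     (\<forall>n\<ge>1. \<forall>as. length as = n \<longrightarrow>
        \<phi>' (prod_list as) = (\<Sum>\<pi>\<in>NC n. part_deriv r r' \<pi> as))"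

definition inf_boolean_cumulants ::
    "(complex \<Rightarrow> 'a::ring_1 \<Rightarrow> 'a) \<Rightarrow> ('a \<Rightarrow> complex) \<Rightarrow> ('a list \<Rightarrow> complex) \<Rightarrow>
     ('a list \<Rightarrow> complex) \<Rightarrow> bool" where
  "inf_boolean_cumulants scale \<phi>' b b' \<longleftrightarrow> multilinear_family scale b' \<and>
     (\<forall>n\<ge>1. \<forall>as. length as = n \<longrightarrow>
        \<phi>' (prod_list as) = (\<Sum>\<pi>\<in>interval_partitions n. part_deriv b b' \<pi> as))"

definition inf_monotone_cumulants ::
    "(complex \<Rightarrow> 'a::ring_1 \<Rightarrow> 'a) \<Rightarrow> ('a \<Rightarrow> complex) \<Rightarrow> ('a list \<Rightarrow> complex) \<Rightarrow>
     ('a list \<Rightarrow> complex) \<Rightarrow> bool" where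
  "inf_monotone_cumulants scale \<phi>' h h' \<longleftrightarrow> multilinear_family scale h' \<and>
     (\<forall>n\<ge>1. \<forall>as. length as = n \<longrightarrow>
        \<phi>' (prod_list as) = (\<Sum>\<pi>\<in>NC n. 1 / of_nat (tree_factorial \<pi>) * part_deriv h h' \<pi> as))"

end

theory Submission
  imports Defs "HOL-Analysis.Derivative"
begin

text \<open>Replacing each family \<open>f\<close> by \<open>f + t f'\<close> and differentiating at \<open>t = 0\<close> reduces the four formulas
  to their non-infinitesimal counterparts, because a moment-cumulant formula determines the
  infinitesimal cumulants. All three kinds of moments are sums over non-crossing partitions, weighted by
  \<open>\<kappa>(\<tau>(\<pi>)!)\<close> with \<open>\<kappa>\<close> multiplicative: \<open>\<kappa> = 1\<close> (free), \<open>\<kappa>(x) = 1/x\<close> (monotone) and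
  \<open>\<kappa>(x) = [x = 1]\<close> (Boolean, as \<open>\<tau>(\<pi>)! = 1\<close> exactly for interval partitions).

  Cutting a non-crossing partition after the largest element of the block of 1 shows that the sum over
  the irreducible partitions gives the Boolean cumulants. For the formulas with signs, let \<open>m * k\<close> be the
  sum over the subwords \<open>S\<close> of \<open>m(S)\<close> times the product of \<open>k\<close> over the gaps of \<open>S\<close>. This is a group law,
  and moments with free cumulants \<open>r\<close> are inverse to moments with Boolean cumulants \<open>-r\<close>. Monotone
  moments of \<open>h\<close> and of \<open>-h\<close> are also inverse, because the moments \<open>M\<^sub>s\<close> of \<open>s h\<close> satisfy
  \<open>d/ds M\<^sub>s = h * M\<^sub>s\<close> and hence form a one-parameter group.\<close>

section \<open>Convolution over the gaps of a subword\<close>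

text \<open>Sum over all subwords \<open>S\<close> of the last argument of \<open>f(S)\<close> times \<open>g\<^sub>0\<close> at the gap before \<open>S\<close> times
  \<open>g\<close> at each of the gaps, possibly empty, that follow a letter of \<open>S\<close>. In the recursion, \<open>x\<close> joins the
  first gap or closes it.\<close>

fun gap_conv :: "('a list \<Rightarrow> 'c::comm_ring_1) \<Rightarrow> ('a list \<Rightarrow> 'c) \<Rightarrow> ('a list \<Rightarrow> 'c) \<Rightarrow> 'a list \<Rightarrow> 'c"
where
  "gap_conv f g\<^sub>0 g [] = f [] * g\<^sub>0 []"
| "gap_conv f g\<^sub>0 g (x # w) =
     gap_conv f (\<lambda>u. g\<^sub>0 (x # u)) g w + g\<^sub>0 [] * gap_conv (\<lambda>u. f (x # u)) g g w"

lemma gap_conv_add_left: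
  "gap_conv (\<lambda>u. f u + f' u) g\<^sub>0 g w = gap_conv f g\<^sub>0 g w + gap_conv f' g\<^sub>0 g w"
  by (induction w arbitrary: f f' g\<^sub>0) (simp_all add: algebra_simps)

lemma gap_conv_scale_left: "gap_conv (\<lambda>u. c * f u) g\<^sub>0 g w = c * gap_conv f g\<^sub>0 g w"
  by (induction w arbitrary: f g\<^sub>0) (simp_all add: algebra_simps)

lemma gap_conv_add_gap:
  "gap_conv f (\<lambda>u. g\<^sub>0 u + g\<^sub>0' u) g w = gap_conv f g\<^sub>0 g w + gap_conv f g\<^sub>0' g w"
  by (induction w arbitrary: f g\<^sub>0 g\<^sub>0') (simp_all add: algebra_simps)

lemma gap_conv_scale_gap: "gap_conv f (\<lambda>u. c * g\<^sub>0 u) g w = c * gap_conv f g\<^sub>0 g w"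
  by (induction w arbitrary: f g\<^sub>0) (simp_all add: algebra_simps)

text \<open>Both sides sum over nested subwords S of T of the word. The left side chooses T first
  and then S inside it; the right side chooses S first and then the letters of T inside each gap of
  S. The gaps of T are exactly the gaps formed inside the gaps of S. The first gap carries its own
  functionals, so that the induction can load letters into it.\<close>

lemma gap_conv_assoc:
  "gap_conv (gap_conv f g\<^sub>0 g) k\<^sub>0 k w = gap_conv f (gap_conv g\<^sub>0 k\<^sub>0 k) (gap_conv g k k) w"
  by (induction w arbitrary: f g\<^sub>0 k\<^sub>0)
    (simp_all add: gap_conv_add_left gap_conv_scale_left gap_conv_add_gap gap_conv_scale_gap
      algebra_simps)

text \<open>A gap that follows a letter of the subword misses that letter, so strictly shorter words
  suffice for \<open>g\<close>; the subword and the first gap can each be the whole word.\<close>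

lemma gap_conv_cong:
  assumes "\<And>u. length u \<le> length w \<Longrightarrow> f u = f' u"
    and "\<And>u. length u \<le> length w \<Longrightarrow> g\<^sub>0 u = g\<^sub>0' u"
    and "\<And>u. length u < length w \<Longrightarrow> g u = g' u"
  shows "gap_conv f g\<^sub>0 g w = gap_conv f' g\<^sub>0' g' w"
  using assms
proof (induction w arbitrary: f f' g\<^sub>0 g\<^sub>0')
  case (Cons x w)
  have "gap_conv f (\<lambda>u. g\<^sub>0 (x # u)) g w = gap_conv f' (\<lambda>u. g\<^sub>0' (x # u)) g' w"
    by (intro Cons.IH) (use Cons.prems in auto)
  moreover have "gap_conv (\<lambda>u. f (x # u)) g g w = gap_conv (\<lambda>u. f' (x # u)) g' g' w"
    by (intro Cons.IH) (use Cons.prems in auto)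
  ultimately show ?case using Cons.prems(2)[of "[]"] by simp
qed simp

text \<open>If \<open>f\<close> vanishes at the empty word, then no gap is the whole word.\<close>

lemma gap_conv_cong_less:
  assumes "f [] = 0"
    and "\<And>u. length u < length w \<Longrightarrow> g\<^sub>0 u = g\<^sub>0' u"
    and "\<And>u. length u < length w \<Longrightarrow> g u = g' u"
  shows "gap_conv f g\<^sub>0 g w = gap_conv f g\<^sub>0' g' w"
  using assms
proof (induction w arbitrary: g\<^sub>0 g\<^sub>0')
  case (Cons x w)
  have "gap_conv f (\<lambda>u. g\<^sub>0 (x # u)) g w = gap_conv f (\<lambda>u. g\<^sub>0' (x # u)) g' w"
    by (intro Cons.IH) (use Cons.prems in auto)
  moreover have "gap_conv (\<lambda>u. f (x # u)) g g w = gap_conv (\<lambda>u. f (x # u)) g' g' w"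
    by (intro gap_conv_cong) (use Cons.prems in auto)
  ultimately show ?case using Cons.prems(2)[of "[]"] by simp
qed simp

text \<open>The two-sided unit of the convolution, by \<open>gap_conv_eps_left\<close> and
  \<open>gap_conv_eps_right\<close>.\<close>

definition eps :: "'a list \<Rightarrow> 'c::comm_ring_1" where
  "eps w = (if w = [] then 1 else 0)"

lemma eps_simps [simp]: "eps [] = 1" "eps (x # w) = 0"
  by (simp_all add: eps_def)

lemma gap_conv_zero_left [simp]: "gap_conv (\<lambda>u. 0) g\<^sub>0 g w = 0"
  using gap_conv_scale_left[of 0 "\<lambda>u. 0"] by simp

lemma gap_conv_zero_gap [simp]: "gap_conv f (\<lambda>u. 0) g w = 0"
  using gap_conv_scale_gap[of f 0 "\<lambda>u. 0"] by simp

lemma gap_conv_eps_left [simp]: "gap_conv eps g\<^sub>0 g w = g\<^sub>0 w"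
  by (induction w arbitrary: g\<^sub>0) simp_all

lemma gap_conv_eps_right [simp]: "gap_conv f eps eps w = f w"
  by (induction w arbitrary: f) simp_all

text \<open>The usual group argument l = l * (m * k) = (l * m) * k = k.\<close>

lemma gap_conv_inverse_unique:
  assumes "gap_conv l m m = eps" and "gap_conv m k k = eps"
  shows "l = k"
proof
  fix w
  have "l w = gap_conv l (gap_conv m k k) (gap_conv m k k) w"
    by (simp add: assms)
  also have "\<dots> = gap_conv (gap_conv l m m) k k w"
    by (simp add: gap_conv_assoc)
  finally show "l w = k w" by (simp add: assms)
qed

section \<open>Cutting a word into a prefix and a suffix\<close>

definition prefix_conv :: "('a list \<Rightarrow> 'c::comm_ring_1) \<Rightarrow> ('a list \<Rightarrow> 'c) \<Rightarrow> 'a list \<Rightarrow> 'c" where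
  "prefix_conv a g w = (\<Sum>i\<le>length w. a (take i w) * g (drop i w))"

lemma prefix_conv_Nil [simp]: "prefix_conv a g [] = a [] * g []"
  by (simp add: prefix_conv_def)

lemma prefix_conv_Cons:
  "prefix_conv a g (x # w) = a [] * g (x # w) + prefix_conv (\<lambda>u. a (x # u)) g w"
  by (simp add: prefix_conv_def sum.atMost_Suc_shift del: sum.atMost_Suc)

lemma prefix_conv_cong:
  assumes "\<And>u. length u \<le> length w \<Longrightarrow> a u = a' u"
    and "\<And>u. length u \<le> length w \<Longrightarrow> g u = g' u"
  shows "prefix_conv a g w = prefix_conv a' g' w"
  unfolding prefix_conv_def by (intro sum.cong refl) (simp add: assms)

lemma prefix_conv_eps [simp]: "prefix_conv a eps w = a w"
  by (induction w arbitrary: a) (simp_all add: prefix_conv_Cons)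

text \<open>The prefix cut off lies inside the first gap, before every letter of the subword; it can
  equally be cut off from the word before the subword is chosen.\<close>

lemma gap_conv_prefix_conv:
  "gap_conv f (prefix_conv a g\<^sub>0) g w = prefix_conv a (gap_conv f g\<^sub>0 g) w"
proof (induction w arbitrary: a)
  case (Cons x w)
  have "gap_conv f (\<lambda>u. prefix_conv a g\<^sub>0 (x # u)) g w
      = a [] * gap_conv f (\<lambda>u. g\<^sub>0 (x # u)) g w + prefix_conv (\<lambda>u. a (x # u)) (gap_conv f g\<^sub>0 g) w"
    by (simp add: prefix_conv_Cons gap_conv_add_gap gap_conv_scale_gap Cons.IH)
  then show ?case by (simp add: prefix_conv_Cons algebra_simps)
qed simp

text \<open>The recursion at \<open>x # w\<close> evaluates its solution only at suffixes of
  \<open>w\<close>, so induction on the length applies.\<close>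

lemma prefix_conv_determined:
  assumes "m [] = m' []" and "\<And>x w. m (x # w) = prefix_conv (\<lambda>u. b (x # u)) m w"
    and "\<And>x w. m' (x # w) = prefix_conv (\<lambda>u. b (x # u)) m' w"
  shows "m = m'"
proof
  fix w show "m w = m' w"
  proof (induction w rule: length_induct)
    case (1 w)
    show ?case
    proof (cases w)
      case (Cons x v)
      then show ?thesis using 1 by (auto simp: assms(2,3) intro!: prefix_conv_cong)
    qed (simp add: assms)
  qed
qed

text \<open>The two recursions are those of moments \<open>m\<close> with free cumulants \<open>r\<close> and of moments \<open>k\<close> with
  Boolean cumulants \<open>-r\<close>.\<close>

lemma free_boolean_inverse:
  assumes "m [] = 1" and m: "\<And>x w. m (x # w) = gap_conv (\<lambda>u. r (x # u)) m m w"
    and "k [] = 1" and k: "\<And>x w. k (x # w) = prefix_conv (\<lambda>u. - r (x # u)) k w"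
  shows "gap_conv m k k = eps"
proof
  fix w show "gap_conv m k k w = eps w"
  proof (induction w rule: length_induct)
    case (1 w)
    show ?case
    proof (cases w)
      case (Cons x v)
      have IH: "gap_conv m k k u = eps u" if "length u \<le> length v" for u
        using 1 that Cons by simp
      \<comment> \<open>The letter \<open>x\<close> lies in the first gap: the Boolean recursion
        splits off a prefix starting with \<open>x\<close> and leaves a convolution on a word
        already known to give \<open>eps\<close>, so only the full prefix survives.\<close>
      have "gap_conv m (\<lambda>u. k (x # u)) k v = prefix_conv (\<lambda>u. - r (x # u)) (gap_conv m k k) v"
        unfolding k by (rule gap_conv_prefix_conv)
      also have "\<dots> = prefix_conv (\<lambda>u. - r (x # u)) eps v"
        by (intro prefix_conv_cong IH) simp_all
      finally have 1: "gap_conv m (\<lambda>u. k (x # u)) k v = - r (x # v)" by simp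
      \<comment> \<open>The letter \<open>x\<close> lies in the subword: the free recursion and
        associativity reduce all gaps to \<open>eps\<close>. What remains is
        \<open>r (x # v)\<close>, which cancels the contribution of the first case.\<close>
      have "gap_conv (\<lambda>u. m (x # u)) k k v
          = gap_conv (\<lambda>u. r (x # u)) (gap_conv m k k) (gap_conv m k k) v"
        unfolding m by (rule gap_conv_assoc)
      also have "\<dots> = gap_conv (\<lambda>u. r (x # u)) eps eps v"
        by (intro gap_conv_cong IH) simp_all
      finally show ?thesis using 1 assms Cons by simp
    qed (simp add: assms)
  qed
qed

section \<open>Non-crossing partitions of finite sets of positions\<close>

text \<open>Arbitrary ground sets are needed because removing a block or cutting a partition leaves
  a partition of some set of positions; the original numbering is kept.\<close>

definition nc_partitions :: "nat set \<Rightarrow> nat set set set" where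
  "nc_partitions A = {\<pi>. partition_on A \<pi> \<and> noncrossing \<pi>}"

lemma NC_eq_nc_partitions: "NC n = nc_partitions {1..n}"
  by (simp add: NC_def partitions_def nc_partitions_def)

lemma noncrossingI:
  assumes "\<And>V W a b c d. \<lbrakk>V \<in> \<pi>; W \<in> \<pi>; a \<in> V; b \<in> W; c \<in> V; d \<in> W; a < b; b < c; c < d\<rbrakk>
    \<Longrightarrow> V = W"
  shows "noncrossing \<pi>"
  unfolding noncrossing_def
proof (rule notI, elim bexE conjE exE)
  fix V W a b c d
  assume "V \<in> \<pi>" "W \<in> \<pi>" "V \<noteq> W" "a < b" "b < c" "c < d" "a \<in> V" "c \<in> V" "b \<in> W" "d \<in> W"
  then show False using assms[of V W a b c d] by simp
qed

lemma noncrossingD: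
  assumes "noncrossing \<pi>" "V \<in> \<pi>" "W \<in> \<pi>" "a \<in> V" "b \<in> W" "c \<in> V" "d \<in> W"
    and "a < b" "b < c" "c < d"
  shows "V = W"
proof (rule ccontr)
  assume "V \<noteq> W"
  moreover have "\<exists>a b c d. a < b \<and> b < c \<and> c < d \<and> a \<in> V \<and> c \<in> V \<and> b \<in> W \<and> d \<in> W"
    by (intro exI conjI) (fact assms)+
  ultimately have "\<exists>V\<in>\<pi>. \<exists>W\<in>\<pi>. V \<noteq> W \<and>
      (\<exists>a b c d. a < b \<and> b < c \<and> c < d \<and> a \<in> V \<and> c \<in> V \<and> b \<in> W \<and> d \<in> W)"
    using assms(2,3) by (intro bexI conjI)
  then show False using assms(1) unfolding noncrossing_def by (rule notE[rotated])
qed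

lemma nc_partitions_same_block:
  assumes "\<pi> \<in> nc_partitions A" "V \<in> \<pi>" "W \<in> \<pi>" "a \<in> V" "a \<in> W"
  shows "V = W"
  using assms by (auto simp: nc_partitions_def partition_on_def disjoint_def)

lemma nc_partitions_block:
  assumes "\<pi> \<in> nc_partitions A" "V \<in> \<pi>"
  shows "V \<subseteq> A" "V \<noteq> {}"
  using assms by (auto simp: nc_partitions_def partition_on_def)

lemma nc_partitions_finite_block:
  assumes "\<pi> \<in> nc_partitions A" "finite A" "V \<in> \<pi>"
  shows "finite V"
  using nc_partitions_block(1)[OF assms(1,3)] assms(2) by (rule finite_subset)

lemma nc_partitions_finite:
  assumes "\<pi> \<in> nc_partitions A" "finite A"
  shows "finite \<pi>"
  using assms(1) finite_elements[OF assms(2)] by (simp add: nc_partitions_def)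

lemma finite_nc_partitions: "finite A \<Longrightarrow> finite (nc_partitions A)"
  by (rule finite_subset[OF _ finitely_many_partition_on]) (auto simp: nc_partitions_def)

lemma nc_partitions_empty [simp]: "nc_partitions {} = {{}}"
  by (auto simp: nc_partitions_def noncrossing_def partition_on_empty)

text \<open>Inclusion in the convex hull of \<open>V\<close>, phrased without \<open>Min\<close> and
  \<open>Max\<close> so that only comparisons of elements occur.\<close>

definition nested_in :: "nat set \<Rightarrow> nat set \<Rightarrow> bool" where
  "nested_in W V \<longleftrightarrow> (\<forall>w\<in>W. (\<exists>a\<in>V. a \<le> w) \<and> (\<exists>b\<in>V. w \<le> b))"

lemma nested_in_iff_hull:
  assumes "finite V" "V \<noteq> {}"
  shows "W \<subseteq> {Min V..Max V} \<longleftrightarrow> nested_in W V"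
proof -
  have "W \<subseteq> {Min V..Max V} \<longleftrightarrow> (\<forall>w\<in>W. Min V \<le> w \<and> w \<le> Max V)" by auto
  then show ?thesis using assms by (simp add: nested_in_def Min_le_iff Max_ge_iff)
qed

lemma nested_in_refl: "nested_in V V"
  by (auto simp: nested_in_def)

lemma nested_blocks_eq_card_nested_in:
  assumes "\<pi> \<in> nc_partitions A" "finite A" "V \<in> \<pi>"
  shows "nested_blocks \<pi> V = card {W \<in> \<pi>. nested_in W V}"
  unfolding nested_blocks_def
    nested_in_iff_hull[OF nc_partitions_finite_block[OF assms] nc_partitions_block(2)[OF assms(1,3)]] ..

lemma nested_blocks_pos:
  assumes "\<pi> \<in> nc_partitions A" "finite A" "V \<in> \<pi>"
  shows "nested_blocks \<pi> V > 0"
proof -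
  have "V \<in> {W \<in> \<pi>. nested_in W V}" using assms(3) nested_in_refl by simp
  moreover have "finite {W \<in> \<pi>. nested_in W V}" using nc_partitions_finite[OF assms(1,2)] by simp
  ultimately show ?thesis
    unfolding nested_blocks_eq_card_nested_in[OF assms] card_gt_0_iff by blast
qed

text \<open>Each block is nested in itself, so every factor is positive. This makes
  \<open>multiplicative\<close>, a condition on positive arguments, applicable to tree
  factorials.\<close>

lemma tree_factorial_pos:
  assumes "\<pi> \<in> nc_partitions A" "finite A"
  shows "tree_factorial \<pi> > 0"
  unfolding tree_factorial_def using nested_blocks_pos[OF assms] by (intro prod_pos) auto

lemma tree_factorial_empty [simp]: "tree_factorial {} = 1"
  by (simp add: tree_factorial_def)

section \<open>Increasing relabellings of the positions\<close>

lemma inj_on_image_blocks: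
  assumes "\<pi> \<in> nc_partitions A" "inj_on e A"
  shows "inj_on ((`) e) \<pi>"
  by (rule inj_on_subset[OF inj_on_image_Pow[OF assms(2)]])
    (use nc_partitions_block(1)[OF assms(1)] in auto)

lemma image_nc_partitions:
  assumes e: "strict_mono_on A e" and \<pi>: "\<pi> \<in> nc_partitions A"
  shows "(`) e ` \<pi> \<in> nc_partitions (e ` A)"
proof -
  have inj: "inj_on e A" using e by (rule strict_mono_on_imp_inj_on)
  have part: "partition_on A \<pi>" using \<pi> by (simp add: nc_partitions_def)
  have "partition_on (e ` A) ((`) e ` \<pi>)"
  proof (rule partition_onI)
    show "\<Union> ((`) e ` \<pi>) = e ` A" using part by (auto simp: partition_on_def)
    fix p q assume pq: "p \<in> (`) e ` \<pi>" "q \<in> (`) e ` \<pi>" "p \<noteq> q"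
    then obtain V W where VW: "V \<in> \<pi>" "W \<in> \<pi>" "p = e ` V" "q = e ` W" by auto
    then have "V \<inter> W = {}" using part pq by (auto simp: partition_on_def disjoint_def)
    then show "disjnt p q"
      using inj_on_image_Int[OF inj nc_partitions_block(1)[OF \<pi> VW(1)] nc_partitions_block(1)[OF \<pi> VW(2)]]
        VW(3,4) by (simp add: disjnt_def)
  next
    show "{} \<notin> (`) e ` \<pi>" using nc_partitions_block(2)[OF \<pi>] by auto
  qed
  moreover have "noncrossing ((`) e ` \<pi>)"
  proof (rule noncrossingI)
    fix P Q a b c d
    assume *: "P \<in> (`) e ` \<pi>" "Q \<in> (`) e ` \<pi>" "a \<in> P" "b \<in> Q" "c \<in> P" "d \<in> Q"
      "a < b" "b < c" "c < d"
    then obtain V W where VW: "V \<in> \<pi>" "W \<in> \<pi>" "P = e ` V" "Q = e ` W" by auto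
    with * obtain a' b' c' d' where
      1: "a' \<in> V" "b' \<in> W" "c' \<in> V" "d' \<in> W" "a = e a'" "b = e b'" "c = e c'" "d = e d'"
      by auto
    then have "a' \<in> A" "b' \<in> A" "c' \<in> A" "d' \<in> A"
      using nc_partitions_block(1)[OF \<pi>] VW by auto
    then have "a' < b'" "b' < c'" "c' < d'"
      using *(7-9) 1 strict_mono_on_less[OF e] by simp_all
    then show "P = Q"
      using noncrossingD[OF _ VW(1,2) 1(1-4)] \<pi> VW by (auto simp: nc_partitions_def)
  qed
  ultimately show ?thesis by (simp add: nc_partitions_def)
qed

text \<open>Nesting of blocks depends only on the relative order of their elements, which an
  increasing map preserves.\<close>

lemma tree_factorial_image:
  assumes e: "strict_mono_on A e" and "finite A" and \<pi>: "\<pi> \<in> nc_partitions A"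
  shows "tree_factorial ((`) e ` \<pi>) = tree_factorial \<pi>"
proof -
  have inj: "inj_on ((`) e) \<pi>"
    using \<pi> strict_mono_on_imp_inj_on[OF e] by (rule inj_on_image_blocks)
  have "nested_blocks ((`) e ` \<pi>) (e ` V) = nested_blocks \<pi> V" if V: "V \<in> \<pi>" for V
  proof -
    have "nested_in (e ` W) (e ` V) \<longleftrightarrow> nested_in W V" if "W \<in> \<pi>" for W
    proof -
      have "W \<subseteq> A" "V \<subseteq> A" using that V nc_partitions_block(1)[OF \<pi>] by auto
      then have "e a \<le> e w \<longleftrightarrow> a \<le> w" "e w \<le> e a \<longleftrightarrow> w \<le> a" if "a \<in> V" "w \<in> W" for a w
        using that strict_mono_on_less_eq[OF e] by blast+
      then show ?thesis by (auto simp: nested_in_def)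
    qed
    then have "{U \<in> (`) e ` \<pi>. nested_in U (e ` V)} = (`) e ` {W \<in> \<pi>. nested_in W V}" by auto
    moreover have "inj_on ((`) e) {W \<in> \<pi>. nested_in W V}" using inj by (rule inj_on_subset) auto
    ultimately show ?thesis
      using nested_blocks_eq_card_nested_in[OF image_nc_partitions[OF e \<pi>]] assms(2) V
        nested_blocks_eq_card_nested_in[OF \<pi>] by (simp add: card_image)
  qed
  then show ?thesis
    unfolding tree_factorial_def by (simp add: prod.reindex[OF inj])
qed

text \<open>The inverse of an increasing map is increasing on the image, so
  \<open>image_nc_partitions\<close> applies in both directions.\<close>

lemma bij_betw_image_nc_partitions:
  assumes e: "strict_mono_on A e"
  shows "bij_betw ((`) ((`) e)) (nc_partitions A) (nc_partitions (e ` A))"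
proof -
  define e' where "e' = inv_into A e"
  have inj: "inj_on e A" using e by (rule strict_mono_on_imp_inj_on)
  have e': "strict_mono_on (e ` A) e'"
  proof (rule strict_mono_onI)
    fix r s assume "r \<in> e ` A" "s \<in> e ` A" "r < s"
    then show "e' r < e' s"
      using inj strict_mono_on_less[OF e] by (auto simp: e'_def)
  qed
  have e'e: "e' ` e ` A = A" using inj by (simp add: e'_def inv_into_image_cancel)
  have 1: "e' ` e ` V = V" if "V \<subseteq> A" for V
    using that inj by (simp add: e'_def inv_into_image_cancel)
  have 2: "e ` e' ` V = V" if "V \<subseteq> e ` A" for V
    using that by (simp add: e'_def image_inv_into_cancel)
  show ?thesis
  proof (rule bij_betw_byWitness[where f' = "(`) ((`) e')"])
    show "\<forall>\<pi>\<in>nc_partitions A. (`) e' ` (`) e ` \<pi> = \<pi>"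
    proof
      fix \<pi> assume "\<pi> \<in> nc_partitions A"
      then have "(\<lambda>V. e' ` e ` V) ` \<pi> = (\<lambda>V. V) ` \<pi>"
        by (intro image_cong refl 1 nc_partitions_block(1))
      then show "(`) e' ` (`) e ` \<pi> = \<pi>" by (simp add: image_image)
    qed
    show "\<forall>\<pi>\<in>nc_partitions (e ` A). (`) e ` (`) e' ` \<pi> = \<pi>"
    proof
      fix \<pi> assume "\<pi> \<in> nc_partitions (e ` A)"
      then have "(\<lambda>V. e ` e' ` V) ` \<pi> = (\<lambda>V. V) ` \<pi>"
        by (intro image_cong refl 2 nc_partitions_block(1))
      then show "(`) e ` (`) e' ` \<pi> = \<pi>" by (simp add: image_image)
    qed
    show "(`) ((`) e) ` nc_partitions A \<subseteq> nc_partitions (e ` A)"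
      using image_nc_partitions[OF e] by auto
    show "(`) ((`) e') ` nc_partitions (e ` A) \<subseteq> nc_partitions A"
      using image_nc_partitions[OF e'] e'e by auto
  qed
qed

section \<open>Weights of partitions and moments of subwords\<close>

definition multiplicative :: "(nat \<Rightarrow> complex) \<Rightarrow> bool" where
  "multiplicative \<kappa> \<longleftrightarrow> \<kappa> 1 = 1 \<and> (\<forall>x>0. \<forall>y>0. \<kappa> (x * y) = \<kappa> x * \<kappa> y)"

definition weight :: "(nat \<Rightarrow> complex) \<Rightarrow> ('a list \<Rightarrow> complex) \<Rightarrow> 'a list \<Rightarrow> nat set set \<Rightarrow> complex" where
  "weight \<kappa> f as \<pi> = \<kappa> (tree_factorial \<pi>) * part_eval f \<pi> as"

definition moment :: "(nat \<Rightarrow> complex) \<Rightarrow> ('a list \<Rightarrow> complex) \<Rightarrow> 'a list \<Rightarrow> complex" where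
  "moment \<kappa> f as = (\<Sum>\<pi>\<in>NC (length as). weight \<kappa> f as \<pi>)"

lemma weight_empty: "multiplicative \<kappa> \<Longrightarrow> weight \<kappa> f as {} = 1"
  by (simp add: weight_def multiplicative_def part_eval_def)

text \<open>\<open>NC 0\<close> contains just the empty partition. In \<open>gap_conv\<close>, an
  empty gap therefore contributes the factor 1.\<close>

lemma moment_Nil: "multiplicative \<kappa> \<Longrightarrow> moment \<kappa> f [] = 1"
  by (simp add: moment_def NC_eq_nc_partitions weight_empty)

lemma length_restrict_args: "finite A \<Longrightarrow> length (restrict_args as A) = card A"
  by (simp add: restrict_args_def)

lemma restrict_args_empty [simp]: "restrict_args as {} = []"
  by (simp add: restrict_args_def)

lemma restrict_args_union:
  assumes "finite E" "finite A" "\<And>x y. x \<in> E \<Longrightarrow> y \<in> A \<Longrightarrow> x < y"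
  shows "restrict_args as (E \<union> A) = restrict_args as E @ restrict_args as A"
proof -
  have "sorted_list_of_set (E \<union> A) = sorted_list_of_set E @ sorted_list_of_set A"
    by (rule sorted_distinct_set_unique) (use assms in \<open>force simp: sorted_append\<close>)+
  then show ?thesis by (simp add: restrict_args_def)
qed

lemma restrict_args_insert_less:
  assumes "finite A" "\<And>y. y \<in> A \<Longrightarrow> x < y"
  shows "restrict_args as (insert x A) = as ! (x - 1) # restrict_args as A"
  using restrict_args_union[of "{x}" A as] assms by (simp add: restrict_args_def)

lemma restrict_args_image:
  assumes e: "strict_mono_on A e" and "finite V" "V \<subseteq> A"
    and "\<And>i. i \<in> V \<Longrightarrow> as ! (i - 1) = as' ! (e i - 1)"
  shows "restrict_args as V = restrict_args as' (e ` V)"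
proof -
  have "sorted_list_of_set (e ` V) = map e (sorted_list_of_set V)"
  proof (rule sorted_distinct_set_unique)
    have "sorted_wrt (\<lambda>x y. e x \<le> e y) (sorted_list_of_set V)"
      by (rule sorted_wrt_mono_rel[where P = "(\<le>)"])
        (use assms strict_mono_on_less_eq[OF e] in \<open>auto simp: subset_eq\<close>)
    then show "sorted (map e (sorted_list_of_set V))" by (simp add: sorted_map)
    show "distinct (map e (sorted_list_of_set V))"
      using assms strict_mono_on_imp_inj_on[OF e] by (auto simp: distinct_map inj_on_subset)
  qed (use assms(2) in simp_all)
  then show ?thesis using assms by (simp add: restrict_args_def)
qed

text \<open>The increasing enumeration of \<open>A\<close> transports partitions of the positions
  inside the subword to partitions of \<open>A\<close> with the same weight. Moments of gaps can
  thus be summed over the original positions.\<close>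

lemma moment_restrict_args:
  assumes "finite A"
  shows "moment \<kappa> f (restrict_args as A) = (\<Sum>\<pi>\<in>nc_partitions A. weight \<kappa> f as \<pi>)"
proof -
  \<comment> \<open>\<open>e i\<close> is the \<open>i\<close>-th smallest element of
    \<open>A\<close>; the shift by 1 passes from positions to list indices.\<close>
  define e where "e i = sorted_list_of_set A ! (i - 1)" for i
  let ?n = "card A"
  have len: "length (sorted_list_of_set A) = ?n" by simp
  have e: "strict_mono_on {1..?n} e"
    unfolding e_def
    by (rule strict_mono_onI)
      (use sorted_wrt_nth_less[OF strict_sorted_list_of_set[of A]] len in auto)
  have "e ` {1..?n} = set (sorted_list_of_set A)"
  proof -
    have "e ` {1..?n} = e ` Suc ` {0..<?n}" by (simp add: atLeastLessThanSuc_atLeastAtMost)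
    also have "\<dots> = (!) (sorted_list_of_set A) ` {0..<?n}"
      unfolding image_image e_def by simp
    also have "\<dots> = set (sorted_list_of_set A)"
      using nth_image[of ?n "sorted_list_of_set A"] len by simp
    finally show ?thesis .
  qed
  then have im: "e ` {1..?n} = A" using assms by simp
  have weight_image: "weight \<kappa> f (restrict_args as A) \<pi> = weight \<kappa> f as ((`) e ` \<pi>)"
    if \<pi>: "\<pi> \<in> nc_partitions {1..?n}" for \<pi>
  proof -
    have inj: "inj_on ((`) e) \<pi>"
      using \<pi> strict_mono_on_imp_inj_on[OF e] by (rule inj_on_image_blocks)
    have "restrict_args (restrict_args as A) V = restrict_args as (e ` V)" if "V \<in> \<pi>" for V
    proof (rule restrict_args_image[OF e])
      show "finite V" using that nc_partitions_finite_block[OF \<pi>] by blast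
      show V: "V \<subseteq> {1..?n}" using that by (rule nc_partitions_block(1)[OF \<pi>])
      show "restrict_args as A ! (i - 1) = as ! (e i - 1)" if "i \<in> V" for i
      proof -
        have "i - 1 < ?n" using V that by fastforce
        then show ?thesis by (simp add: restrict_args_def e_def del: One_nat_def)
      qed
    qed
    then have "part_eval f \<pi> (restrict_args as A) = part_eval f ((`) e ` \<pi>) as"
      unfolding part_eval_def prod.reindex[OF inj] o_def by (intro prod.cong) simp_all
    then show ?thesis
      unfolding weight_def tree_factorial_image[OF e finite_atLeastAtMost \<pi>] by simp
  qed
  have "moment \<kappa> f (restrict_args as A) = (\<Sum>\<pi>\<in>nc_partitions {1..?n}. weight \<kappa> f as ((`) e ` \<pi>))"
    by (simp add: moment_def NC_eq_nc_partitions length_restrict_args[OF assms] weight_image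
        del: One_nat_def)
  also have "\<dots> = (\<Sum>\<pi>\<in>nc_partitions (e ` {1..?n}). weight \<kappa> f as \<pi>)"
    by (rule sum.reindex_bij_betw[OF bij_betw_image_nc_partitions[OF e]])
  finally show ?thesis unfolding im .
qed

section \<open>Partitions of two sets one of which precedes the other\<close>

lemma nc_partitions_union:
  assumes \<sigma>: "\<sigma> \<in> nc_partitions E" and \<rho>: "\<rho> \<in> nc_partitions B"
    and less: "\<And>x y. x \<in> E \<Longrightarrow> y \<in> B \<Longrightarrow> x < y"
  shows "\<sigma> \<union> \<rho> \<in> nc_partitions (E \<union> B)"
proof -
  have "E \<inter> B = {}" using less by fastforce
  then have "partition_on (E \<union> B) (\<sigma> \<union> \<rho>)"
    using \<sigma> \<rho> disjoint_union[of \<sigma> \<rho>] by (auto simp: nc_partitions_def partition_on_def)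
  moreover have "noncrossing (\<sigma> \<union> \<rho>)"
  proof (rule noncrossingI)
    fix V W a b c d
    assume *: "V \<in> \<sigma> \<union> \<rho>" "W \<in> \<sigma> \<union> \<rho>" "a \<in> V" "b \<in> W" "c \<in> V" "d \<in> W"
      "a < b" "b < c" "c < d"
    consider "V \<in> \<sigma>" "W \<in> \<sigma>" | "V \<in> \<rho>" "W \<in> \<rho>" | "V \<in> \<sigma>" "W \<in> \<rho>" | "V \<in> \<rho>" "W \<in> \<sigma>"
      using * by auto
    then show "V = W"
    proof cases
      case 1
      then show ?thesis using noncrossingD[OF _ 1 *(3-9)] \<sigma> by (simp add: nc_partitions_def)
    next
      case 2
      then show ?thesis using noncrossingD[OF _ 2 *(3-9)] \<rho> by (simp add: nc_partitions_def)
    next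
      case 3
      then have "c < b"
        using less[of c b] * nc_partitions_block(1)[OF \<sigma>] nc_partitions_block(1)[OF \<rho>] by blast
      then show ?thesis using * by simp
    next
      case 4
      then have "b < a"
        using less[of b a] * nc_partitions_block(1)[OF \<sigma>] nc_partitions_block(1)[OF \<rho>] by blast
      then show ?thesis using * by simp
    qed
  qed
  ultimately show ?thesis by (simp add: nc_partitions_def)
qed

lemma nc_partitions_subset:
  assumes "\<pi> \<in> nc_partitions A" "\<pi>' \<subseteq> \<pi>"
  shows "\<pi>' \<in> nc_partitions (\<Union>\<pi>')"
proof -
  have "partition_on (\<Union>\<pi>') \<pi>'"
    using assms by (auto simp: nc_partitions_def partition_on_def disjoint_def)
  moreover have "noncrossing \<pi>'"
  proof (rule noncrossingI)
    fix V W a b c d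
    assume *: "V \<in> \<pi>'" "W \<in> \<pi>'" "a \<in> V" "b \<in> W" "c \<in> V" "d \<in> W" "a < b" "b < c" "c < d"
    then have "V \<in> \<pi>" "W \<in> \<pi>" using assms(2) by auto
    then show "V = W" using noncrossingD[of \<pi>, OF _ _ _ *(3-9)] assms(1) by (simp add: nc_partitions_def)
  qed
  ultimately show ?thesis by (simp add: nc_partitions_def)
qed

lemma nc_partitions_part:
  assumes "\<pi> \<in> nc_partitions A" "\<And>W. W \<in> \<pi> \<Longrightarrow> W \<subseteq> B \<or> W \<inter> B = {}" "B \<subseteq> A"
  shows "{W \<in> \<pi>. W \<subseteq> B} \<in> nc_partitions B"
proof -
  have "\<Union>{W \<in> \<pi>. W \<subseteq> B} = B"
  proof (intro equalityI subsetI)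
    fix x assume "x \<in> B"
    moreover from this have "x \<in> \<Union>\<pi>"
      using assms(1,3) by (auto simp: nc_partitions_def partition_on_def)
    ultimately show "x \<in> \<Union>{W \<in> \<pi>. W \<subseteq> B}" using assms(2) by blast
  qed auto
  then show ?thesis using nc_partitions_subset[OF assms(1), of "{W \<in> \<pi>. W \<subseteq> B}"] by simp
qed

text \<open>The hull of a block of \<sigma> ends before the hull of any block of \<rho> begins, so
  no block of one is nested in a block of the other and every number N(V) stays the same.\<close>

lemma tree_factorial_union:
  assumes \<sigma>: "\<sigma> \<in> nc_partitions E" and \<rho>: "\<rho> \<in> nc_partitions B" and fin: "finite E" "finite B"
    and less: "\<And>x y. x \<in> E \<Longrightarrow> y \<in> B \<Longrightarrow> x < y"
  shows "tree_factorial (\<sigma> \<union> \<rho>) = tree_factorial \<sigma> * tree_factorial \<rho>" "\<sigma> \<inter> \<rho> = {}"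
proof -
  have un: "\<sigma> \<union> \<rho> \<in> nc_partitions (E \<union> B)" using \<sigma> \<rho> less by (rule nc_partitions_union)
  show disj: "\<sigma> \<inter> \<rho> = {}"
    using nc_partitions_block[OF \<sigma>] nc_partitions_block[OF \<rho>] less by fastforce
  have not_nested: "\<not> nested_in V W" "\<not> nested_in W V" if VW: "V \<in> \<sigma>" "W \<in> \<rho>" for V W
  proof -
    obtain v w where vw: "v \<in> V" "w \<in> W"
      using nc_partitions_block(2)[OF \<sigma> VW(1)] nc_partitions_block(2)[OF \<rho> VW(2)] by auto
    have lt: "x < y" if "x \<in> V" "y \<in> W" for x y
      using that VW less nc_partitions_block(1)[OF \<sigma>] nc_partitions_block(1)[OF \<rho>] by blast
    show "\<not> nested_in V W" "\<not> nested_in W V"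
      using vw lt unfolding nested_in_def by (meson leD)+
  qed
  have "nested_blocks (\<sigma> \<union> \<rho>) V = nested_blocks \<sigma> V" if "V \<in> \<sigma>" for V
  proof -
    have "{W \<in> \<sigma> \<union> \<rho>. nested_in W V} = {W \<in> \<sigma>. nested_in W V}" using not_nested that by blast
    then show ?thesis
      using nested_blocks_eq_card_nested_in[OF un] nested_blocks_eq_card_nested_in[OF \<sigma>] that fin
      by simp
  qed
  moreover have "nested_blocks (\<sigma> \<union> \<rho>) V = nested_blocks \<rho> V" if "V \<in> \<rho>" for V
  proof -
    have "{W \<in> \<sigma> \<union> \<rho>. nested_in W V} = {W \<in> \<rho>. nested_in W V}" using not_nested that by blast
    then show ?thesis
      using nested_blocks_eq_card_nested_in[OF un] nested_blocks_eq_card_nested_in[OF \<rho>] that fin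
      by simp
  qed
  moreover have "finite \<sigma>" "finite \<rho>"
    using nc_partitions_finite[OF \<sigma>] nc_partitions_finite[OF \<rho>] fin by auto
  ultimately show "tree_factorial (\<sigma> \<union> \<rho>) = tree_factorial \<sigma> * tree_factorial \<rho>"
    unfolding tree_factorial_def by (simp add: prod.union_disjoint disj)
qed

lemma weight_union:
  assumes \<sigma>: "\<sigma> \<in> nc_partitions E" and \<rho>: "\<rho> \<in> nc_partitions B" and fin: "finite E" "finite B"
    and less: "\<And>x y. x \<in> E \<Longrightarrow> y \<in> B \<Longrightarrow> x < y" and "multiplicative \<kappa>"
  shows "weight \<kappa> f as (\<sigma> \<union> \<rho>) = weight \<kappa> f as \<sigma> * weight \<kappa> f as \<rho>"
proof -
  have "finite \<sigma>" "finite \<rho>"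
    using nc_partitions_finite[OF \<sigma>] nc_partitions_finite[OF \<rho>] fin by auto
  then show ?thesis
    using tree_factorial_union[OF assms(1-5)] tree_factorial_pos[OF \<sigma>] tree_factorial_pos[OF \<rho>]
      fin assms(6)
    by (simp add: weight_def part_eval_def prod.union_disjoint multiplicative_def)
qed

text \<open>A partition without a block meeting both sets is the union of its blocks in
  \<open>E\<close> and its blocks in \<open>B\<close>, and the weight factors. The index sets stay
  abstract because one application restricts \<open>P\<close> to irreducible partitions and another
  restricts \<open>Q\<close> to separated ones.\<close>

lemma sum_weight_split:
  assumes fin: "finite E" "finite B" and less: "\<And>x y. x \<in> E \<Longrightarrow> y \<in> B \<Longrightarrow> x < y"
    and \<kappa>: "multiplicative \<kappa>"
    and P: "P \<subseteq> nc_partitions E" and Q: "Q \<subseteq> nc_partitions B"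
    and un: "\<And>\<sigma> \<rho>. \<sigma> \<in> P \<Longrightarrow> \<rho> \<in> Q \<Longrightarrow> \<sigma> \<union> \<rho> \<in> S"
    and split: "\<And>\<pi> W. \<pi> \<in> S \<Longrightarrow> W \<in> \<pi> \<Longrightarrow> W \<subseteq> E \<or> W \<subseteq> B"
    and left: "\<And>\<pi>. \<pi> \<in> S \<Longrightarrow> {W \<in> \<pi>. W \<subseteq> E} \<in> P"
    and right: "\<And>\<pi>. \<pi> \<in> S \<Longrightarrow> {W \<in> \<pi>. W \<subseteq> B} \<in> Q"
  shows "(\<Sum>\<pi>\<in>S. weight \<kappa> f as \<pi>) = (\<Sum>\<sigma>\<in>P. weight \<kappa> f as \<sigma>) * (\<Sum>\<rho>\<in>Q. weight \<kappa> f as \<rho>)"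
proof -
  have disj: "E \<inter> B = {}" using less by fastforce
  have not_both: "\<not> (W \<subseteq> E \<and> W \<subseteq> B)" if "W \<noteq> {}" for W using that disj by blast
  have "(\<Sum>\<sigma>\<in>P. weight \<kappa> f as \<sigma>) * (\<Sum>\<rho>\<in>Q. weight \<kappa> f as \<rho>)
      = (\<Sum>(\<sigma>, \<rho>)\<in>P \<times> Q. weight \<kappa> f as \<sigma> * weight \<kappa> f as \<rho>)"
    by (simp add: sum_product sum.cartesian_product)
  also have "\<dots> = (\<Sum>\<pi>\<in>S. weight \<kappa> f as \<pi>)"
  proof (rule sum.reindex_bij_witness[where i = "\<lambda>\<pi>. ({W \<in> \<pi>. W \<subseteq> E}, {W \<in> \<pi>. W \<subseteq> B})"
        and j = "\<lambda>(\<sigma>, \<rho>). \<sigma> \<union> \<rho>"])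
    fix x assume "x \<in> P \<times> Q"
    then obtain \<sigma> \<rho> where x: "x = (\<sigma>, \<rho>)" "\<sigma> \<in> P" "\<rho> \<in> Q" by auto
    then have \<sigma>: "\<sigma> \<in> nc_partitions E" and \<rho>: "\<rho> \<in> nc_partitions B" using P Q by auto
    have s: "W \<subseteq> E" "\<not> W \<subseteq> B" if "W \<in> \<sigma>" for W
      using nc_partitions_block[OF \<sigma> that] not_both by blast+
    have r: "W \<subseteq> B" "\<not> W \<subseteq> E" if "W \<in> \<rho>" for W
      using nc_partitions_block[OF \<rho> that] not_both by blast+
    have "{W \<in> \<sigma> \<union> \<rho>. W \<subseteq> E} = \<sigma>" using s(1) r(2) by auto
    moreover have "{W \<in> \<sigma> \<union> \<rho>. W \<subseteq> B} = \<rho>" using s(2) r(1) by auto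
    ultimately show "({W \<in> (case x of (\<sigma>, \<rho>) \<Rightarrow> \<sigma> \<union> \<rho>). W \<subseteq> E},
        {W \<in> (case x of (\<sigma>, \<rho>) \<Rightarrow> \<sigma> \<union> \<rho>). W \<subseteq> B}) = x"
      by (simp add: x(1))
    show "(case x of (\<sigma>, \<rho>) \<Rightarrow> \<sigma> \<union> \<rho>) \<in> S" using un x by simp
    show "weight \<kappa> f as (case x of (\<sigma>, \<rho>) \<Rightarrow> \<sigma> \<union> \<rho>)
        = (case x of (\<sigma>, \<rho>) \<Rightarrow> weight \<kappa> f as \<sigma> * weight \<kappa> f as \<rho>)"
      using weight_union[OF \<sigma> \<rho> fin less \<kappa>] x by simp
  next
    fix \<pi> assume \<pi>: "\<pi> \<in> S"
    then show "({W \<in> \<pi>. W \<subseteq> E}, {W \<in> \<pi>. W \<subseteq> B}) \<in> P \<times> Q" using left right by simp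
    have "{W \<in> \<pi>. W \<subseteq> E} \<union> {W \<in> \<pi>. W \<subseteq> B} = \<pi>" using split[OF \<pi>] by auto
    then show "(case ({W \<in> \<pi>. W \<subseteq> E}, {W \<in> \<pi>. W \<subseteq> B}) of (\<sigma>, \<rho>) \<Rightarrow> \<sigma> \<union> \<rho>) = \<pi>" by simp
  qed
  finally show ?thesis by simp
qed

text \<open>A block \<open>W\<close> disjoint from \<open>V\<close> is separated from it if it lies within one gap of \<open>V\<close>.\<close>

definition separated :: "nat set \<Rightarrow> nat set \<Rightarrow> bool" where
  "separated V W \<longleftrightarrow> (\<forall>a\<in>W. \<forall>b\<in>W. \<forall>v\<in>V. \<not> (a < v \<and> v < b))"

text \<open>For nonempty \<open>V\<close> and \<open>B = A - V\<close>, this is what remains of the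
  non-crossing partitions of \<open>A\<close> having \<open>V\<close> as an outer block, by
  \<open>separated_nc_insert\<close> and \<open>nc_partitions_remove_outer\<close>.\<close>

definition separated_nc :: "nat set \<Rightarrow> nat set \<Rightarrow> nat set set set" where
  "separated_nc V B = {\<sigma> \<in> nc_partitions B. \<forall>W\<in>\<sigma>. separated V W}"

text \<open>For multiplicative \<open>\<kappa>\<close> this is the product of the moments of the
  gaps of \<open>V\<close> in \<open>A\<close>: a separated partition amounts to one partition of
  each gap.\<close>

definition complement_moment ::
    "(nat \<Rightarrow> complex) \<Rightarrow> ('a list \<Rightarrow> complex) \<Rightarrow> 'a list \<Rightarrow> nat set \<Rightarrow> nat set \<Rightarrow> complex" where
  "complement_moment \<kappa> f as V A = (\<Sum>\<sigma>\<in>separated_nc V (A - V). weight \<kappa> f as \<sigma>)"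

text \<open>The new first element \<open>x\<close> closes the gap \<open>E\<close>. A separated
  block cannot reach across \<open>x\<close>; conversely, blocks inside \<open>E\<close> are
  separated from elements that all lie to their right.\<close>

lemma complement_moment_insert:
  assumes fin: "finite E" "finite A" and \<kappa>: "multiplicative \<kappa>" and V: "V \<subseteq> A"
    and E: "\<And>y. y \<in> E \<Longrightarrow> y < x" and A: "\<And>y. y \<in> A \<Longrightarrow> x < y"
  shows "complement_moment \<kappa> f as (insert x V) (E \<union> insert x A)
    = moment \<kappa> f (restrict_args as E) * complement_moment \<kappa> f as V A"
proof -
  have less: "y < z" if "y \<in> E" "z \<in> A - V" for y z
    using that E[of y] A[of z] by simp
  have disj: "E \<inter> (A - V) = {}" using less by fastforce
  have "x \<notin> E" "x \<notin> A" using E A by auto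
  then have eq: "(E \<union> insert x A) - insert x V = E \<union> (A - V)"
    using V E A by fastforce
  have "(\<Sum>\<pi>\<in>separated_nc (insert x V) (E \<union> (A - V)). weight \<kappa> f as \<pi>)
    = (\<Sum>\<sigma>\<in>nc_partitions E. weight \<kappa> f as \<sigma>) * (\<Sum>\<rho>\<in>separated_nc V (A - V). weight \<kappa> f as \<rho>)"
  proof (rule sum_weight_split)
    show "nc_partitions E \<subseteq> nc_partitions E" "separated_nc V (A - V) \<subseteq> nc_partitions (A - V)"
      by (auto simp: separated_nc_def)
    fix \<sigma> \<rho> assume \<sigma>: "\<sigma> \<in> nc_partitions E" and \<rho>: "\<rho> \<in> separated_nc V (A - V)"
    have "separated (insert x V) W" if "W \<in> \<sigma>" for W
    proof -
      have "b < v" if "b \<in> W" "v \<in> insert x V" for b v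
      proof -
        have "b < x" using E that(1) nc_partitions_block(1)[OF \<sigma> \<open>W \<in> \<sigma>\<close>] by blast
        moreover have "x \<le> v" using that(2) A V by fastforce
        ultimately show ?thesis by simp
      qed
      then show ?thesis unfolding separated_def by (meson less_asym)
    qed
    moreover have "separated (insert x V) W" if "W \<in> \<rho>" for W
    proof -
      have "x < b" if "b \<in> W" for b
        using that A nc_partitions_block(1)[of \<rho> "A - V" W] \<rho> \<open>W \<in> \<rho>\<close> by (auto simp: separated_nc_def)
      moreover have "separated V W" using \<rho> that by (simp add: separated_nc_def)
      ultimately show ?thesis unfolding separated_def by (metis insert_iff less_asym)
    qed
    ultimately show "\<sigma> \<union> \<rho> \<in> separated_nc (insert x V) (E \<union> (A - V))"
      using nc_partitions_union[OF \<sigma> _ less, of \<rho>] \<rho> by (auto simp: separated_nc_def)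
  next
    fix \<pi> assume \<pi>: "\<pi> \<in> separated_nc (insert x V) (E \<union> (A - V))"
    then have nc: "\<pi> \<in> nc_partitions (E \<union> (A - V))" by (simp add: separated_nc_def)
    show split: "W \<subseteq> E \<or> W \<subseteq> A - V" if W: "W \<in> \<pi>" for W
    proof (rule ccontr)
      assume "\<not> (W \<subseteq> E \<or> W \<subseteq> A - V)"
      then obtain a b where "a \<in> W" "a \<in> E" "b \<in> W" "b \<in> A - V"
        using nc_partitions_block(1)[OF nc W] by blast
      moreover have "separated (insert x V) W" using \<pi> W by (simp add: separated_nc_def)
      ultimately show False using E[of a] A[of b] by (auto simp: separated_def)
    qed
    show "{W \<in> \<pi>. W \<subseteq> E} \<in> nc_partitions E"
      using nc by (rule nc_partitions_part) (use split disj in blast)+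
    have "{W \<in> \<pi>. W \<subseteq> A - V} \<in> nc_partitions (A - V)"
      using nc by (rule nc_partitions_part) (use split disj in blast)+
    then show "{W \<in> \<pi>. W \<subseteq> A - V} \<in> separated_nc V (A - V)"
      using \<pi> by (auto simp: separated_nc_def separated_def)
  qed (use fin less \<kappa> in auto)
  then show ?thesis
    unfolding complement_moment_def eq moment_restrict_args[OF fin(1)] .
qed

text \<open>This turns a convolution with moments into a sum over candidate blocks \<open>V\<close>.
  The set \<open>E\<close> holds the positions already read into the open first gap; removing the
  least element of \<open>A\<close> in the induction matches the recursion of
  \<open>gap_conv\<close>.\<close>

lemma gap_conv_moment:
  assumes \<kappa>: "multiplicative \<kappa>" and fin: "finite A" "finite E"
    and less: "\<And>x y. x \<in> E \<Longrightarrow> y \<in> A \<Longrightarrow> x < y"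
  shows "gap_conv f (\<lambda>u. moment \<kappa> k (restrict_args as E @ u)) (moment \<kappa> k) (restrict_args as A)
    = (\<Sum>V\<in>Pow A. f (restrict_args as V) * complement_moment \<kappa> k as V (E \<union> A))"
  using fin less
proof (induction A arbitrary: f E rule: finite_linorder_min_induct)
  case empty
  then show ?case
    by (simp add: complement_moment_def separated_nc_def separated_def moment_restrict_args)
next
  case (insert x A)
  have xA: "x \<notin> A" using insert.hyps by auto
  have E: "y < x" if "y \<in> E" for y using insert.prems that by simp
  have fin: "finite A" "finite E" using insert by auto
  let ?a = "as ! (x - 1)"
  have cons: "restrict_args as (insert x V) = ?a # restrict_args as V" if "V \<in> Pow A" for V
    using that insert.hyps fin(1) by (intro restrict_args_insert_less) (auto intro: finite_subset)
  \<comment> \<open>First summand of the recursion: \<open>x\<close> joins the open gap, so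
    \<open>E\<close> grows to \<open>insert x E\<close>.\<close>
  have "gap_conv f (\<lambda>u. moment \<kappa> k (restrict_args as E @ ?a # u)) (moment \<kappa> k) (restrict_args as A)
      = gap_conv f (\<lambda>u. moment \<kappa> k (restrict_args as (insert x E) @ u)) (moment \<kappa> k) (restrict_args as A)"
    using restrict_args_union[of E "{x}" as] E fin by (simp add: restrict_args_def)
  also have "\<dots> = (\<Sum>V\<in>Pow A. f (restrict_args as V) * complement_moment \<kappa> k as V (insert x E \<union> A))"
    by (rule insert.IH) (use insert fin in auto)
  finally have 1: "gap_conv f (\<lambda>u. moment \<kappa> k (restrict_args as E @ ?a # u)) (moment \<kappa> k) (restrict_args as A)
      = (\<Sum>V\<in>Pow A. f (restrict_args as V) * complement_moment \<kappa> k as V (E \<union> insert x A))"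
    by simp
  \<comment> \<open>Second summand: \<open>x\<close> joins the subword and closes \<open>E\<close>,
    and an empty gap opens behind it.\<close>
  have "gap_conv (\<lambda>u. f (?a # u)) (moment \<kappa> k) (moment \<kappa> k) (restrict_args as A)
      = (\<Sum>V\<in>Pow A. f (?a # restrict_args as V) * complement_moment \<kappa> k as V A)"
    using insert.IH[of "{}" "\<lambda>u. f (?a # u)"] by simp
  also have "moment \<kappa> k (restrict_args as E) * \<dots> = (\<Sum>V\<in>Pow A. f (restrict_args as (insert x V)) *
      complement_moment \<kappa> k as (insert x V) (E \<union> insert x A))"
    unfolding sum_distrib_left
  proof (rule sum.cong)
    fix V assume V: "V \<in> Pow A"
    have "complement_moment \<kappa> k as (insert x V) (E \<union> insert x A)
        = moment \<kappa> k (restrict_args as E) * complement_moment \<kappa> k as V A"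
      by (rule complement_moment_insert) (use V fin \<kappa> E insert.hyps in auto)
    then show "moment \<kappa> k (restrict_args as E) * (f (?a # restrict_args as V) * complement_moment \<kappa> k as V A)
      = f (restrict_args as (insert x V)) * complement_moment \<kappa> k as (insert x V) (E \<union> insert x A)"
      by (simp add: cons[OF V])
  qed simp
  also have "\<dots> = (\<Sum>V\<in>insert x ` Pow A. f (restrict_args as V) * complement_moment \<kappa> k as V (E \<union> insert x A))"
    by (subst sum.reindex) (use xA in \<open>auto simp: inj_on_def\<close>)
  finally have 2: "moment \<kappa> k (restrict_args as E) * gap_conv (\<lambda>u. f (?a # u)) (moment \<kappa> k) (moment \<kappa> k) (restrict_args as A)
      = (\<Sum>V\<in>insert x ` Pow A. f (restrict_args as V) * complement_moment \<kappa> k as V (E \<union> insert x A))" .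
  have "Pow A \<inter> insert x ` Pow A = {}" using xA by auto
  then show ?case
    using 1 2 cons[of A] fin by (simp add: Pow_insert sum.union_disjoint)
qed

section \<open>Recursions for the moments\<close>

text \<open>For multiplicative \<open>\<kappa>\<close> these are the Boolean cumulants of
  \<open>moment \<kappa> f\<close>, see \<open>moment_kronecker_one_irr_moment\<close>.\<close>

definition irr_moment :: "(nat \<Rightarrow> complex) \<Rightarrow> ('a list \<Rightarrow> complex) \<Rightarrow> 'a list \<Rightarrow> complex" where
  "irr_moment \<kappa> f as = (\<Sum>\<pi>\<in>NC_irr (length as). weight \<kappa> f as \<pi>)"

lemma weight_cong:
  assumes "\<And>V. V \<in> \<pi> \<Longrightarrow> restrict_args as V = restrict_args as' V"
  shows "weight \<kappa> f as \<pi> = weight \<kappa> f as' \<pi>"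
  using assms by (simp add: weight_def part_eval_def)

lemma restrict_args_take:
  assumes "V \<subseteq> {1..y}"
  shows "restrict_args (take y as) V = restrict_args as V"
proof -
  have "finite V" using assms by (rule finite_subset) simp
  then show ?thesis using assms by (force simp: restrict_args_def)
qed

lemma restrict_args_drop: "restrict_args as {Suc y..length as} = drop y as"
proof -
  have "sorted_list_of_set {Suc y..length as} = [Suc y..<Suc (length as)]"
    using sorted_list_of_set_range[of "Suc y" "Suc (length as)"]
    by (simp only: atLeastLessThanSuc_atLeastAtMost)
  then show ?thesis
    by (auto simp: restrict_args_def intro!: nth_equalityI simp del: upt_Suc)
qed

text \<open>Sort the partitions by the largest element \<open>y\<close> of the block of 1. Another
  block with elements on both sides of \<open>y\<close> would cross that block, so the partition
  splits into an irreducible one of \<open>{1..y}\<close> and an arbitrary one behind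
  \<open>y\<close>.\<close>

lemma moment_Cons_irr_moment:
  assumes \<kappa>: "multiplicative \<kappa>"
  shows "moment \<kappa> f (x # w) = prefix_conv (\<lambda>u. irr_moment \<kappa> f (x # u)) (moment \<kappa> f) w"
proof -
  let ?as = "x # w" and ?n = "Suc (length w)"
  define S where "S y = {\<pi> \<in> nc_partitions {1..?n}. \<exists>V\<in>\<pi>. 1 \<in> V \<and> y \<in> V \<and> (\<forall>z\<in>V. z \<le> y)}" for y
  have un: "nc_partitions {1..?n} = (\<Union>y\<in>{1..?n}. S y)"
  proof (intro equalityI subsetI)
    fix \<pi> assume \<pi>: "\<pi> \<in> nc_partitions {1..?n}"
    then have "1 \<in> \<Union>\<pi>" by (auto simp: nc_partitions_def partition_on_def)
    then obtain V where V: "V \<in> \<pi>" "1 \<in> V" by auto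
    have "finite V" using nc_partitions_finite_block[OF \<pi> _ V(1)] by simp
    moreover have "V \<noteq> {}" using V by blast
    ultimately have "Max V \<in> V" "\<forall>z\<in>V. z \<le> Max V" by auto
    then have "\<pi> \<in> S (Max V)" "Max V \<in> {1..?n}"
      using V \<pi> nc_partitions_block(1)[OF \<pi> V(1)] by (auto simp: S_def)
    then show "\<pi> \<in> (\<Union>y\<in>{1..?n}. S y)" by blast
  qed (auto simp: S_def)
  have disj: "S y \<inter> S z = {}" if "y \<noteq> z" for y z
  proof (rule ccontr)
    assume "S y \<inter> S z \<noteq> {}"
    then obtain \<pi> V W where *: "\<pi> \<in> nc_partitions {1..?n}" "V \<in> \<pi>" "W \<in> \<pi>" "1 \<in> V" "1 \<in> W"
      "y \<in> V" "\<forall>u\<in>V. u \<le> y" "z \<in> W" "\<forall>u\<in>W. u \<le> z"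
      unfolding S_def by blast
    then have "V = W" using nc_partitions_same_block by blast
    then have "y \<le> z" "z \<le> y" using * by auto
    then show False using that by simp
  qed
  have fin: "finite (S y)" for y by (simp add: S_def finite_nc_partitions)
  have "(\<Sum>\<pi>\<in>nc_partitions {1..?n}. weight \<kappa> f ?as \<pi>)
      = (\<Sum>y\<in>{1..?n}. \<Sum>\<pi>\<in>S y. weight \<kappa> f ?as \<pi>)"
    unfolding un by (rule sum.UNION_disjoint) (use disj fin in auto)
  then have "moment \<kappa> f ?as = (\<Sum>y\<in>{1..?n}. \<Sum>\<pi>\<in>S y. weight \<kappa> f ?as \<pi>)"
    by (simp only: moment_def NC_eq_nc_partitions list.size add_0_right add_Suc_right)
  also have "\<dots> = (\<Sum>y\<in>{1..?n}. irr_moment \<kappa> f (take y ?as) * moment \<kappa> f (drop y ?as))"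
  proof (rule sum.cong)
    fix y assume y: "y \<in> {1..?n}"
    have less: "a < b" if "a \<in> {1..y}" "b \<in> {Suc y..?n}" for a b using that by simp
    have eq: "{1..y} \<union> {Suc y..?n} = {1..?n}" using y by auto
    have "(\<Sum>\<pi>\<in>S y. weight \<kappa> f ?as \<pi>) = (\<Sum>\<sigma>\<in>NC_irr y. weight \<kappa> f ?as \<sigma>) *
        (\<Sum>\<rho>\<in>nc_partitions {Suc y..?n}. weight \<kappa> f ?as \<rho>)"
    proof (rule sum_weight_split)
      show "NC_irr y \<subseteq> nc_partitions {1..y}" by (auto simp: NC_irr_def NC_eq_nc_partitions)
      fix \<sigma> \<rho> assume \<sigma>: "\<sigma> \<in> NC_irr y" and \<rho>: "\<rho> \<in> nc_partitions {Suc y..?n}"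
      from \<sigma> obtain V where nc: "\<sigma> \<in> nc_partitions {1..y}" and V: "V \<in> \<sigma>" "1 \<in> V" "y \<in> V"
        by (auto simp: NC_irr_def NC_eq_nc_partitions)
      have "\<forall>z\<in>V. z \<le> y" using nc_partitions_block(1)[OF nc V(1)] by auto
      then show "\<sigma> \<union> \<rho> \<in> S y"
        using nc_partitions_union[OF nc \<rho> less] V unfolding S_def eq by blast
    next
      fix \<pi> assume \<pi>: "\<pi> \<in> S y"
      then obtain V where nc: "\<pi> \<in> nc_partitions {1..?n}"
        and V: "V \<in> \<pi>" "1 \<in> V" "y \<in> V" "\<forall>z\<in>V. z \<le> y"
        by (auto simp: S_def)
      show split: "W \<subseteq> {1..y} \<or> W \<subseteq> {Suc y..?n}" if W: "W \<in> \<pi>" for W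
      proof (rule ccontr)
        assume "\<not> (W \<subseteq> {1..y} \<or> W \<subseteq> {Suc y..?n})"
        then obtain a b where ab: "a \<in> W" "b \<in> W" "a \<notin> {Suc y..?n}" "b \<notin> {1..y}" by blast
        then have "a \<in> {1..?n}" "b \<in> {1..?n}" using nc_partitions_block(1)[OF nc W] by auto
        then have "1 \<le> a" "a \<le> y" "y < b" using ab by auto
        have "V \<noteq> W" using ab V \<open>y < b\<close> by auto
        then have "1 \<notin> W" "y \<notin> W" using nc_partitions_same_block[OF nc V(1) W] V by auto
        then have "a \<noteq> 1" "a \<noteq> y" using ab by auto
        then have "1 < a" "a < y" using \<open>1 \<le> a\<close> \<open>a \<le> y\<close> by auto
        then have "V = W"
          using noncrossingD[of \<pi> V W 1 a y b] nc V W ab \<open>y < b\<close> by (simp add: nc_partitions_def)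
        then show False using \<open>V \<noteq> W\<close> by simp
      qed
      have "{W \<in> \<pi>. W \<subseteq> {1..y}} \<in> nc_partitions {1..y}"
      proof (rule nc_partitions_part[OF nc])
        show "W \<subseteq> {1..y} \<or> W \<inter> {1..y} = {}" if "W \<in> \<pi>" for W using split[OF that] by fastforce
      qed (use y in simp)
      moreover have "V \<subseteq> {1..y}" using V nc_partitions_block(1)[OF nc V(1)] by auto
      ultimately show "{W \<in> \<pi>. W \<subseteq> {1..y}} \<in> NC_irr y"
        using V unfolding NC_irr_def NC_eq_nc_partitions by blast
      show "{W \<in> \<pi>. W \<subseteq> {Suc y..?n}} \<in> nc_partitions {Suc y..?n}"
      proof (rule nc_partitions_part[OF nc])
        show "W \<subseteq> {Suc y..?n} \<or> W \<inter> {Suc y..?n} = {}" if "W \<in> \<pi>" for W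
          using split[OF that] by fastforce
      qed (use y in simp)
    qed (use less \<kappa> in auto)
    also have "(\<Sum>\<rho>\<in>nc_partitions {Suc y..?n}. weight \<kappa> f ?as \<rho>) = moment \<kappa> f (drop y ?as)"
      using moment_restrict_args[of "{Suc y..?n}" \<kappa> f ?as] restrict_args_drop[of ?as y] by simp
    also have "(\<Sum>\<sigma>\<in>NC_irr y. weight \<kappa> f ?as \<sigma>) = irr_moment \<kappa> f (take y ?as)"
    proof -
      have "length (take y ?as) = y" using y by simp
      moreover have "weight \<kappa> f ?as \<sigma> = weight \<kappa> f (take y ?as) \<sigma>" if "\<sigma> \<in> NC_irr y" for \<sigma>
        by (rule weight_cong, rule restrict_args_take[symmetric])
          (use that nc_partitions_block(1) in \<open>auto simp: NC_irr_def NC_eq_nc_partitions\<close>)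
      ultimately show ?thesis unfolding irr_moment_def by simp
    qed
    finally show "(\<Sum>\<pi>\<in>S y. weight \<kappa> f ?as \<pi>) = irr_moment \<kappa> f (take y ?as) * moment \<kappa> f (drop y ?as)" .
  qed simp
  also have "\<dots> = prefix_conv (\<lambda>u. irr_moment \<kappa> f (x # u)) (moment \<kappa> f) w"
    \<comment> \<open>Here \<open>y = i + 1\<close>: the prefix of length \<open>y\<close> of
      \<open>x # w\<close> is \<open>x\<close> followed by \<open>i\<close> letters of
      \<open>w\<close>.\<close>
    unfolding prefix_conv_def One_nat_def sum.shift_bounds_cl_Suc_ivl by (simp add: atMost_atLeast0)
  finally show ?thesis .
qed

section \<open>Outer blocks, the roots of the nesting forest\<close>

definition outer :: "nat set set \<Rightarrow> nat set set" where
  "outer \<pi> = {V \<in> \<pi>. \<forall>W\<in>\<pi> - {V}. separated V W}"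

text \<open>A crossing of \<open>V\<close> with another block would place an element of
  \<open>V\<close> strictly between two elements of that block, which separation forbids.\<close>

lemma separated_nc_insert:
  assumes V: "V \<subseteq> A" "V \<noteq> {}" and \<sigma>: "\<sigma> \<in> separated_nc V (A - V)"
  shows "insert V \<sigma> \<in> nc_partitions A" "V \<notin> \<sigma>" "V \<in> outer (insert V \<sigma>)"
proof -
  have nc: "\<sigma> \<in> nc_partitions (A - V)" and sep: "\<And>W. W \<in> \<sigma> \<Longrightarrow> separated V W"
    using \<sigma> by (auto simp: separated_nc_def)
  show "V \<notin> \<sigma>" using nc_partitions_block(1)[OF nc, of V] V by blast
  then show "V \<in> outer (insert V \<sigma>)" using sep by (auto simp: outer_def)
  have "disjnt V (\<Union>\<sigma>)" using nc by (auto simp: nc_partitions_def partition_on_def disjnt_def)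
  then have "partition_on A (insert V \<sigma>)"
    using partition_on_insert[of V \<sigma> A] nc V by (simp add: nc_partitions_def)
  moreover have "noncrossing (insert V \<sigma>)"
  proof (rule noncrossingI)
    fix U W a b c d
    assume *: "U \<in> insert V \<sigma>" "W \<in> insert V \<sigma>" "a \<in> U" "b \<in> W" "c \<in> U" "d \<in> W"
      "a < b" "b < c" "c < d"
    consider "U \<in> \<sigma>" "W \<in> \<sigma>" | "U = V" "W = V" | "U \<in> \<sigma>" "W = V" | "U = V" "W \<in> \<sigma>"
      using * by auto
    then show "U = W"
    proof cases
      case 1
      then show ?thesis using noncrossingD[OF _ 1 *(3-9)] nc by (simp add: nc_partitions_def)
    next
      case 3
      then show ?thesis using sep[of U] * by (auto simp: separated_def)
    next
      case 4
      then show ?thesis using sep[of W] * by (auto simp: separated_def)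
    qed simp
  qed
  ultimately show "insert V \<sigma> \<in> nc_partitions A" by (simp add: nc_partitions_def)
qed

lemma nc_partitions_remove_outer:
  assumes \<pi>: "\<pi> \<in> nc_partitions A" and V: "V \<in> outer \<pi>"
  shows "\<pi> - {V} \<in> separated_nc V (A - V)"
proof -
  have "V \<in> \<pi>" using V by (simp add: outer_def)
  have "\<Union>(\<pi> - {V}) = A - V"
  proof (intro equalityI subsetI)
    fix x assume "x \<in> \<Union>(\<pi> - {V})"
    then obtain W where W: "W \<in> \<pi>" "W \<noteq> V" "x \<in> W" by auto
    then have "x \<notin> V" using nc_partitions_same_block[OF \<pi> W(1) \<open>V \<in> \<pi>\<close>] by auto
    then show "x \<in> A - V" using W nc_partitions_block(1)[OF \<pi> W(1)] by auto
  next
    fix x assume x: "x \<in> A - V"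
    then have "x \<in> \<Union>\<pi>" using \<pi> by (auto simp: nc_partitions_def partition_on_def)
    then show "x \<in> \<Union>(\<pi> - {V})" using x by auto
  qed
  then have "\<pi> - {V} \<in> nc_partitions (A - V)"
    using nc_partitions_subset[OF \<pi>, of "\<pi> - {V}"] by auto
  then show ?thesis using V by (auto simp: separated_nc_def outer_def)
qed

text \<open>Pairs of a block and a separated partition of its complement correspond to partitions
  with a marked outer block. The predicate \<open>Q\<close> limits the marks: to the block of 1 in
  the free case, not at all in the monotone case.\<close>

lemma sum_outer_blocks:
  assumes fin: "finite A"
  shows "(\<Sum>V\<in>{V. V \<subseteq> A \<and> V \<noteq> {} \<and> Q V}. \<Sum>\<sigma>\<in>separated_nc V (A - V). F V \<sigma>)
    = (\<Sum>\<pi>\<in>nc_partitions A. \<Sum>V\<in>{V \<in> outer \<pi>. Q V}. F V (\<pi> - {V}))"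
proof -
  have "finite {V. V \<subseteq> A \<and> V \<noteq> {} \<and> Q V}" using fin by simp
  moreover have "finite (separated_nc V (A - V))" for V
    using finite_nc_partitions[of "A - V"] fin by (simp add: separated_nc_def)
  ultimately have "(\<Sum>V\<in>{V. V \<subseteq> A \<and> V \<noteq> {} \<and> Q V}. \<Sum>\<sigma>\<in>separated_nc V (A - V). F V \<sigma>)
      = (\<Sum>(V, \<sigma>)\<in>(SIGMA V:{V. V \<subseteq> A \<and> V \<noteq> {} \<and> Q V}. separated_nc V (A - V)). F V \<sigma>)"
    by (simp add: sum.Sigma)
  also have "\<dots> = (\<Sum>(\<pi>, V)\<in>(SIGMA \<pi>:nc_partitions A. {V \<in> outer \<pi>. Q V}). F V (\<pi> - {V}))"
  proof (rule sum.reindex_bij_witness[where i = "\<lambda>(\<pi>, V). (V, \<pi> - {V})"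
        and j = "\<lambda>(V, \<sigma>). (insert V \<sigma>, V)"])
    fix p assume "p \<in> (SIGMA V:{V. V \<subseteq> A \<and> V \<noteq> {} \<and> Q V}. separated_nc V (A - V))"
    then obtain V \<sigma> where p: "p = (V, \<sigma>)" "V \<subseteq> A" "V \<noteq> {}" "Q V" "\<sigma> \<in> separated_nc V (A - V)"
      by auto
    note ins = separated_nc_insert[OF p(2,3,5)]
    show "(case case p of (V, \<sigma>) \<Rightarrow> (insert V \<sigma>, V) of (\<pi>, V) \<Rightarrow> (V, \<pi> - {V})) = p"
      "(case p of (V, \<sigma>) \<Rightarrow> (insert V \<sigma>, V)) \<in> (SIGMA \<pi>:nc_partitions A. {V \<in> outer \<pi>. Q V})"
      "(case case p of (V, \<sigma>) \<Rightarrow> (insert V \<sigma>, V) of (\<pi>, V) \<Rightarrow> F V (\<pi> - {V}))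
        = (case p of (V, \<sigma>) \<Rightarrow> F V \<sigma>)"
      using p ins by auto
  next
    fix p assume "p \<in> (SIGMA \<pi>:nc_partitions A. {V \<in> outer \<pi>. Q V})"
    then obtain \<pi> V where p: "p = (\<pi>, V)" "\<pi> \<in> nc_partitions A" "V \<in> outer \<pi>" "Q V" by auto
    have "V \<in> \<pi>" using p(3) by (simp add: outer_def)
    then show "(case case p of (\<pi>, V) \<Rightarrow> (V, \<pi> - {V}) of (V, \<sigma>) \<Rightarrow> (insert V \<sigma>, V)) = p"
      "(case p of (\<pi>, V) \<Rightarrow> (V, \<pi> - {V}))
        \<in> (SIGMA V:{V. V \<subseteq> A \<and> V \<noteq> {} \<and> Q V}. separated_nc V (A - V))"
      using p nc_partitions_remove_outer[OF p(2,3)] nc_partitions_block[OF p(2)] by auto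
  qed
  also have "\<dots> = (\<Sum>\<pi>\<in>nc_partitions A. \<Sum>V\<in>{V \<in> outer \<pi>. Q V}. F V (\<pi> - {V}))"
  proof (rule sum.Sigma[symmetric])
    show "finite (nc_partitions A)" using fin by (rule finite_nc_partitions)
    show "\<forall>\<pi>\<in>nc_partitions A. finite {V \<in> outer \<pi>. Q V}"
      using nc_partitions_finite[OF _ fin] by (auto simp: outer_def)
  qed
  finally show ?thesis .
qed

text \<open>If another block had elements \<open>a\<close> and \<open>b\<close> around an element
  \<open>v\<close> of \<open>V\<close>, then \<open>x < a < v < b\<close> would be a
  crossing.\<close>

lemma block_of_min_outer:
  assumes \<pi>: "\<pi> \<in> nc_partitions A" and V: "V \<in> \<pi>" "x \<in> V" and min: "\<And>y. y \<in> A \<Longrightarrow> x \<le> y"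
  shows "V \<in> outer \<pi>"
proof -
  have "separated V W" if W: "W \<in> \<pi>" "W \<noteq> V" for W
    unfolding separated_def
  proof (intro ballI notI)
    fix a b v assume *: "a \<in> W" "b \<in> W" "v \<in> V" "a < v \<and> v < b"
    have "x \<le> a" using min nc_partitions_block(1)[OF \<pi> W(1)] * by auto
    moreover have "x \<noteq> a" using nc_partitions_same_block[OF \<pi> W(1) V(1)] W * V by auto
    ultimately have "V = W"
      using noncrossingD[of \<pi> V W x a v b] \<pi> V W * by (simp add: nc_partitions_def)
    then show False using W by simp
  qed
  then show ?thesis using V by (auto simp: outer_def)
qed

text \<open>The block of 1 is outer, so removing it leaves one non-crossing partition in each gap,
  and the constant weight does not register the removal.\<close>

lemma moment_Cons_free:
  "moment (\<lambda>_. 1) f (x # w) = gap_conv (\<lambda>u. f (x # u)) (moment (\<lambda>_. 1) f) (moment (\<lambda>_. 1) f) w"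
proof -
  let ?\<kappa> = "\<lambda>_::nat. 1::complex" and ?as = "x # w"
  define n where "n = length ?as"
  have \<kappa>: "multiplicative ?\<kappa>" by (simp add: multiplicative_def)
  have eq: "{} \<union> insert 1 {2..n} = {1..n}" by (auto simp: n_def)
  have w: "w = restrict_args ?as {2..n}"
    using restrict_args_drop[of ?as 1] by (simp add: n_def numeral_2_eq_2)
  have cons: "restrict_args ?as (insert 1 V) = x # restrict_args ?as V" if "V \<subseteq> {2..n}" for V
  proof -
    have "finite V" using that by (rule finite_subset) simp
    then show ?thesis using restrict_args_insert_less[of V 1 ?as] that by fastforce
  qed
  have insert_bij: "bij_betw (insert 1) (Pow {2..n}) {V. V \<subseteq> {1..n} \<and> V \<noteq> {} \<and> 1 \<in> V}"
  proof (rule bij_betw_byWitness[where f' = "\<lambda>V. V - {1}"])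
    show "insert 1 ` Pow {2..n} \<subseteq> {V. V \<subseteq> {1..n} \<and> V \<noteq> {} \<and> 1 \<in> V}"
      unfolding eq[symmetric] by auto
    show "(\<lambda>V. V - {1}) ` {V. V \<subseteq> {1..n} \<and> V \<noteq> {} \<and> 1 \<in> V} \<subseteq> Pow {2..n}"
      unfolding eq[symmetric] by auto
    show "\<forall>V\<in>Pow {2..n}. insert 1 V - {1} = V" by (auto simp: subset_iff)
  qed auto
  have "gap_conv (\<lambda>u. f (x # u)) (moment ?\<kappa> f) (moment ?\<kappa> f) w
      = (\<Sum>V\<in>Pow {2..n}. f (x # restrict_args ?as V) * complement_moment ?\<kappa> f ?as V {2..n})"
    using gap_conv_moment[OF \<kappa>, of "{2..n}" "{}" "\<lambda>u. f (x # u)" f ?as] w by simp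
  also have "\<dots> = (\<Sum>V\<in>Pow {2..n}. f (restrict_args ?as (insert 1 V)) *
      complement_moment ?\<kappa> f ?as (insert 1 V) {1..n})"
  proof (rule sum.cong)
    fix V assume V: "V \<in> Pow {2..n}"
    \<comment> \<open>Adding 1 to the block only adds the empty gap in front of 1, whose moment is
      1.\<close>
    have "complement_moment ?\<kappa> f ?as (insert 1 V) ({} \<union> insert 1 {2..n})
        = moment ?\<kappa> f (restrict_args ?as {}) * complement_moment ?\<kappa> f ?as V {2..n}"
      by (rule complement_moment_insert) (use \<kappa> V in auto)
    then show "f (x # restrict_args ?as V) * complement_moment ?\<kappa> f ?as V {2..n}
        = f (restrict_args ?as (insert 1 V)) * complement_moment ?\<kappa> f ?as (insert 1 V) {1..n}"
      unfolding eq using cons V by (simp add: moment_Nil[OF \<kappa>])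
  qed simp
  also have "\<dots> = (\<Sum>V\<in>{V. V \<subseteq> {1..n} \<and> V \<noteq> {} \<and> 1 \<in> V}.
      f (restrict_args ?as V) * complement_moment ?\<kappa> f ?as V {1..n})"
    by (rule sum.reindex_bij_betw[OF insert_bij])
  also have "\<dots> = (\<Sum>V\<in>{V. V \<subseteq> {1..n} \<and> V \<noteq> {} \<and> 1 \<in> V}. \<Sum>\<sigma>\<in>separated_nc V ({1..n} - V).
      f (restrict_args ?as V) * part_eval f \<sigma> ?as)"
    by (simp add: complement_moment_def weight_def sum_distrib_left)
  also have "\<dots> = (\<Sum>\<pi>\<in>nc_partitions {1..n}. \<Sum>V\<in>{V \<in> outer \<pi>. 1 \<in> V}.
      f (restrict_args ?as V) * part_eval f (\<pi> - {V}) ?as)"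
    by (rule sum_outer_blocks) simp
  also have "\<dots> = (\<Sum>\<pi>\<in>nc_partitions {1..n}. part_eval f \<pi> ?as)"
  proof (rule sum.cong)
    fix \<pi> assume \<pi>: "\<pi> \<in> nc_partitions {1..n}"
    then have "1 \<in> \<Union>\<pi>" by (auto simp: nc_partitions_def partition_on_def n_def)
    then obtain V where V: "V \<in> \<pi>" "1 \<in> V" by auto
    then have "V \<in> outer \<pi>" by (rule block_of_min_outer[OF \<pi>]) simp
    moreover have "W = V" if "W \<in> outer \<pi>" "1 \<in> W" for W
      using nc_partitions_same_block[OF \<pi> _ V(1) that(2) V(2)] that by (simp add: outer_def)
    ultimately have "{V \<in> outer \<pi>. 1 \<in> V} = {V}" using V by blast
    moreover have "finite \<pi>" using nc_partitions_finite[OF \<pi>] by simp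
    ultimately show "(\<Sum>V\<in>{V \<in> outer \<pi>. 1 \<in> V}. f (restrict_args ?as V) * part_eval f (\<pi> - {V}) ?as)
        = part_eval f \<pi> ?as"
      using V by (simp add: part_eval_def prod.remove)
  qed simp
  also have "\<dots> = moment ?\<kappa> f ?as"
    by (simp add: moment_def NC_eq_nc_partitions weight_def n_def)
  finally show ?thesis ..
qed

section \<open>Monotone moments as a one-parameter group\<close>

text \<open>Existence: among the blocks whose hull contains \<open>W\<close>, take one with the
  longest hull; a block around it would have a longer hull still containing \<open>W\<close>.
  Uniqueness: two outer blocks whose hulls share a point cannot both be separated from each
  other.\<close>

lemma nested_in_outer_unique:
  assumes \<pi>: "\<pi> \<in> nc_partitions A" and fin: "finite A" and W: "W \<in> \<pi>"
  shows "card {V \<in> outer \<pi>. nested_in W V} = 1"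
proof -
  let ?S = "{V \<in> \<pi>. nested_in W V}" and ?g = "\<lambda>V. Max V - Min V"
  have blk: "finite V" "V \<noteq> {}" if "V \<in> \<pi>" for V
    using nc_partitions_finite_block[OF \<pi> fin that] nc_partitions_block(2)[OF \<pi> that] by auto
  have "finite ?S" "?S \<noteq> {}"
    using nc_partitions_finite[OF \<pi> fin] W nested_in_refl by auto
  then have "Max (?g ` ?S) \<in> ?g ` ?S" by (intro Max_in) auto
  then obtain V where V: "V \<in> \<pi>" "nested_in W V" "?g V = Max (?g ` ?S)" by auto
  have max: "?g U \<le> ?g V" if "U \<in> \<pi>" "nested_in W U" for U
    unfolding V(3) by (rule Max_ge) (use \<open>finite ?S\<close> that in auto)
  have "separated V U" if U: "U \<in> \<pi>" "U \<noteq> V" for U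
    unfolding separated_def
  proof (intro ballI notI)
    fix a b v assume *: "a \<in> U" "b \<in> U" "v \<in> V" "a < v \<and> v < b"
    \<comment> \<open>As \<open>U\<close> and \<open>V\<close> do not cross, one element of
      \<open>V\<close> between \<open>a\<close> and \<open>b\<close> forces all of \<open>V\<close>
      to lie there.\<close>
    have between: "a < u \<and> u < b" if u: "u \<in> V" for u
    proof (rule ccontr)
      assume "\<not> (a < u \<and> u < b)"
      moreover have "u \<noteq> a" "u \<noteq> b"
        using nc_partitions_same_block[OF \<pi> V(1) U(1) u] U(2) * by auto
      ultimately consider "u < a" | "b < u" by linarith
      then show False
      proof cases
        case 1
        then show False
          using noncrossingD[of \<pi> V U u a v b] \<pi> V U u * by (simp add: nc_partitions_def)
      next
        case 2
        then show False
          using noncrossingD[of \<pi> U V a v b u] \<pi> V U u * by (simp add: nc_partitions_def)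
      qed
    qed
    have "nested_in W U"
      unfolding nested_in_def
    proof
      fix w assume "w \<in> W"
      then obtain c d where "c \<in> V" "c \<le> w" "d \<in> V" "w \<le> d"
        using V(2) by (auto simp: nested_in_def)
      then have "a \<le> w" "w \<le> b" using between[of c] between[of d] by auto
      then show "(\<exists>a\<in>U. a \<le> w) \<and> (\<exists>b\<in>U. w \<le> b)" using * by auto
    qed
    then have "?g U \<le> ?g V" using max U by simp
    moreover have "a < Min V" "Max V < b" "Min V \<le> Max V"
      using between blk[OF V(1)] by auto
    moreover have "Min U \<le> a" "b \<le> Max U" using * blk[OF U(1)] by auto
    ultimately show False by linarith
  qed
  then have V_outer: "V \<in> outer \<pi>" using V by (auto simp: outer_def)
  have "U = V" if U: "U \<in> outer \<pi>" "nested_in W U" for U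
  proof (rule ccontr)
    assume ne: "U \<noteq> V"
    have "U \<in> \<pi>" using U by (simp add: outer_def)
    obtain w where "w \<in> W" using blk(2)[OF W] by auto
    then obtain a b c d where *: "a \<in> U" "a \<le> w" "b \<in> U" "w \<le> b" "c \<in> V" "c \<le> w" "d \<in> V" "w \<le> d"
      using U(2) V(2) unfolding nested_in_def by meson
    have neq: "x \<noteq> y" if "x \<in> U" "y \<in> V" for x y
      using nc_partitions_same_block[OF \<pi> \<open>U \<in> \<pi>\<close> V(1), of x] ne that by auto
    have "separated U V" "separated V U"
      using U(1) V_outer ne V(1) \<open>U \<in> \<pi>\<close> by (auto simp: outer_def)
    \<comment> \<open>Both hulls contain \<open>w\<close>, so the later of \<open>a\<close> and
      \<open>c\<close> lies strictly between two elements of the other block.\<close>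
    moreover have "a < c \<and> c < b \<or> c < a \<and> a < d"
      using neq[of a c] neq[of b c] neq[of a d] * by linarith
    ultimately show False using * unfolding separated_def by blast
  qed
  then have "{V \<in> outer \<pi>. nested_in W V} = {V}" using V_outer V by blast
  then show ?thesis by simp
qed

text \<open>Double counting of the pairs of a block \<open>W\<close> and an outer block
  \<open>V\<close> with \<open>W\<close> nested in \<open>V\<close>: each \<open>W\<close> occurs
  once.\<close>

lemma sum_nested_blocks_outer:
  assumes \<pi>: "\<pi> \<in> nc_partitions A" and fin: "finite A"
  shows "(\<Sum>V\<in>outer \<pi>. nested_blocks \<pi> V) = card \<pi>"
proof -
  have fin\<pi>: "finite \<pi>" and "finite (outer \<pi>)"
    using nc_partitions_finite[OF \<pi> fin] by (auto simp: outer_def)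
  have "(\<Sum>V\<in>outer \<pi>. nested_blocks \<pi> V) = (\<Sum>V\<in>outer \<pi>. \<Sum>W\<in>\<pi>. if nested_in W V then 1 else 0)"
    using nested_blocks_eq_card_nested_in[OF \<pi> fin] fin\<pi>
    by (intro sum.cong) (simp_all add: outer_def flip: sum.inter_filter)
  also have "\<dots> = (\<Sum>W\<in>\<pi>. \<Sum>V\<in>outer \<pi>. if nested_in W V then 1 else 0)"
    by (rule sum.swap)
  also have "\<dots> = (\<Sum>W\<in>\<pi>. 1)"
    using nested_in_outer_unique[OF \<pi> fin] \<open>finite (outer \<pi>)\<close>
    by (intro sum.cong) (simp_all flip: sum.inter_filter)
  finally show ?thesis by simp
qed

text \<open>An outer block is nested in no other block, so its removal leaves the numbers N(W) of
  the others unchanged.\<close>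

lemma tree_factorial_remove_outer:
  assumes \<pi>: "\<pi> \<in> nc_partitions A" and fin: "finite A" and V: "V \<in> outer \<pi>"
  shows "tree_factorial \<pi> = nested_blocks \<pi> V * tree_factorial (\<pi> - {V})"
proof -
  have "V \<in> \<pi>" using V by (simp add: outer_def)
  have nc: "\<pi> - {V} \<in> nc_partitions (A - V)"
    using nc_partitions_remove_outer[OF \<pi> V] by (simp add: separated_nc_def)
  have "nested_blocks (\<pi> - {V}) W = nested_blocks \<pi> W" if W: "W \<in> \<pi> - {V}" for W
  proof -
    have "\<not> nested_in V W"
    proof
      assume nested: "nested_in V W"
      obtain v where "v \<in> V" using nc_partitions_block(2)[OF \<pi> \<open>V \<in> \<pi>\<close>] by auto
      with nested obtain a b where ab: "a \<in> W" "a \<le> v" "b \<in> W" "v \<le> b"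
        by (auto simp: nested_in_def)
      have "v \<notin> W" using nc_partitions_same_block[OF \<pi> \<open>V \<in> \<pi>\<close>, of W v] W \<open>v \<in> V\<close> by auto
      then have "a < v" "v < b" using ab by (auto simp: order.order_iff_strict)
      then show False using V W ab \<open>v \<in> V\<close> by (auto simp: outer_def separated_def)
    qed
    then have "{U \<in> \<pi> - {V}. nested_in U W} = {U \<in> \<pi>. nested_in U W}" by auto
    then show ?thesis
      using nested_blocks_eq_card_nested_in[OF nc] nested_blocks_eq_card_nested_in[OF \<pi>] W fin
      by simp
  qed
  then show ?thesis
    unfolding tree_factorial_def
    using prod.remove[OF nc_partitions_finite[OF \<pi> fin] \<open>V \<in> \<pi>\<close>, of "nested_blocks \<pi>"] by simp
qed

definition recip :: "nat \<Rightarrow> complex" where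
  "recip x = 1 / of_nat x"

lemma multiplicative_recip: "multiplicative recip"
  by (simp add: multiplicative_def recip_def)

lemma part_eval_scale:
  assumes "finite \<pi>"
  shows "part_eval (\<lambda>u. c * f u) \<pi> as = c ^ card \<pi> * part_eval f \<pi> as"
  by (simp add: part_eval_def prod.distrib)

text \<open>Removing the block \<open>V\<close> divides the tree factorial by \<open>N(V)\<close>, and each block lies in the hull of
  exactly one outer block; so summing over the outer blocks reproduces the number of blocks.\<close>

lemma sum_recip_card_blocks:
  fixes h :: "'a list \<Rightarrow> complex"
  defines "h\<^sub>0 \<equiv> \<lambda>u. if u = [] then 0 else h u"
  shows "(\<Sum>\<pi>\<in>NC (length as). of_nat (card \<pi>) * s ^ (card \<pi> - 1) * weight recip h as \<pi>)
    = gap_conv h\<^sub>0 (moment recip (\<lambda>u. s * h u)) (moment recip (\<lambda>u. s * h u)) as"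
proof -
  let ?A = "{1..length as}" and ?f = "\<lambda>u. s * h u"
  have as: "restrict_args as ?A = as"
    using restrict_args_drop[of as 0] by simp
  have "gap_conv h\<^sub>0 (moment recip ?f) (moment recip ?f) as
      = (\<Sum>V\<in>Pow ?A. h\<^sub>0 (restrict_args as V) * complement_moment recip ?f as V ?A)"
    using gap_conv_moment[OF multiplicative_recip, of ?A "{}" h\<^sub>0 ?f as] as by simp
  also have "\<dots> = (\<Sum>V\<in>{V. V \<subseteq> ?A \<and> V \<noteq> {} \<and> True}.
      h (restrict_args as V) * complement_moment recip ?f as V ?A)"
  \<comment> \<open>The value 0 of \<open>h\<^sub>0\<close> at the empty word discards
    \<open>V = {}\<close>, which is not a block.\<close>
  proof (rule sum.mono_neutral_cong_right)
    show "h\<^sub>0 (restrict_args as V) * complement_moment recip ?f as V ?A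
        = h (restrict_args as V) * complement_moment recip ?f as V ?A"
      if "V \<in> {V. V \<subseteq> ?A \<and> V \<noteq> {} \<and> True}" for V
    proof -
      have "finite V" using that finite_subset[of V ?A] by simp
      then have "restrict_args as V \<noteq> []"
        using that length_restrict_args[of V as] by auto
      then show ?thesis by (simp add: h\<^sub>0_def)
    qed
  qed (auto simp: h\<^sub>0_def)
  also have "\<dots> = (\<Sum>V\<in>{V. V \<subseteq> ?A \<and> V \<noteq> {} \<and> True}. \<Sum>\<sigma>\<in>separated_nc V (?A - V).
      h (restrict_args as V) * weight recip ?f as \<sigma>)"
    by (simp add: complement_moment_def sum_distrib_left)
  also have "\<dots> = (\<Sum>\<pi>\<in>nc_partitions ?A. \<Sum>V\<in>{V \<in> outer \<pi>. True}.
      h (restrict_args as V) * weight recip ?f as (\<pi> - {V}))"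
    by (rule sum_outer_blocks) simp
  also have "\<dots> = (\<Sum>\<pi>\<in>nc_partitions ?A. of_nat (card \<pi>) * s ^ (card \<pi> - 1) * weight recip h as \<pi>)"
  proof (rule sum.cong)
    fix \<pi> assume \<pi>: "\<pi> \<in> nc_partitions ?A"
    have fin: "finite \<pi>" using nc_partitions_finite[OF \<pi>] by simp
    have "h (restrict_args as V) * weight recip ?f as (\<pi> - {V})
        = of_nat (nested_blocks \<pi> V) * (s ^ (card \<pi> - 1) * weight recip h as \<pi>)"
      if V: "V \<in> outer \<pi>" for V
    proof -
      have "V \<in> \<pi>" using V by (simp add: outer_def)
      then have "part_eval h \<pi> as = h (restrict_args as V) * part_eval h (\<pi> - {V}) as"
        using fin by (simp add: part_eval_def prod.remove)
      moreover have "tree_factorial \<pi> = nested_blocks \<pi> V * tree_factorial (\<pi> - {V})"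
        by (rule tree_factorial_remove_outer[OF \<pi> finite_atLeastAtMost V])
      moreover have "nested_blocks \<pi> V > 0"
        by (rule nested_blocks_pos[OF \<pi> finite_atLeastAtMost \<open>V \<in> \<pi>\<close>])
      ultimately show ?thesis
        using fin \<open>V \<in> \<pi>\<close> by (simp add: weight_def recip_def part_eval_scale)
    qed
    then have "(\<Sum>V\<in>{V \<in> outer \<pi>. True}. h (restrict_args as V) * weight recip ?f as (\<pi> - {V}))
        = of_nat (\<Sum>V\<in>outer \<pi>. nested_blocks \<pi> V) * (s ^ (card \<pi> - 1) * weight recip h as \<pi>)"
      by (simp add: sum_distrib_right)
    also have "\<dots> = of_nat (card \<pi>) * s ^ (card \<pi> - 1) * weight recip h as \<pi>"
      using sum_nested_blocks_outer[OF \<pi>] by simp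
    finally show "(\<Sum>V\<in>{V \<in> outer \<pi>. True}. h (restrict_args as V) * weight recip ?f as (\<pi> - {V}))
        = of_nat (card \<pi>) * s ^ (card \<pi> - 1) * weight recip h as \<pi>" .
  qed simp
  finally show ?thesis by (simp add: NC_eq_nc_partitions)
qed

lemma moment_scale:
  "moment \<kappa> (\<lambda>u. s * f u) as = (\<Sum>\<pi>\<in>NC (length as). s ^ card \<pi> * weight \<kappa> f as \<pi>)"
  unfolding moment_def
proof (rule sum.cong)
  fix \<pi> assume "\<pi> \<in> NC (length as)"
  then have "finite \<pi>" using nc_partitions_finite by (auto simp: NC_eq_nc_partitions)
  then show "weight \<kappa> (\<lambda>u. s * f u) as \<pi> = s ^ card \<pi> * weight \<kappa> f as \<pi>"
    by (simp add: weight_def part_eval_scale)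
qed simp

text \<open>By \<open>moment_scale\<close> the moment is a polynomial in \<open>s\<close>;
  differentiating termwise produces the factor \<open>card \<pi>\<close>, and
  \<open>sum_recip_card_blocks\<close> recognises the result as a convolution.\<close>

lemma moment_recip_scale_deriv:
  fixes h :: "'a list \<Rightarrow> complex"
  defines "h\<^sub>0 \<equiv> \<lambda>u. if u = [] then 0 else h u"
  shows "((\<lambda>s. moment recip (\<lambda>u. s * h u) as) has_field_derivative
    gap_conv h\<^sub>0 (moment recip (\<lambda>u. s * h u)) (moment recip (\<lambda>u. s * h u)) as) (at s)"
  unfolding moment_scale h\<^sub>0_def sum_recip_card_blocks[symmetric]
  by (auto intro!: derivative_eq_intros sum.cong)

text \<open>\<open>gap_conv\<close> is linear in its left argument and evaluates it at finitely many
  words.\<close>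

lemma gap_conv_deriv:
  fixes F :: "complex \<Rightarrow> 'a list \<Rightarrow> complex"
  assumes "\<And>u. ((\<lambda>s. F s u) has_field_derivative F' u) (at s)"
  shows "((\<lambda>s. gap_conv (F s) g\<^sub>0 g w) has_field_derivative gap_conv F' g\<^sub>0 g w) (at s)"
  using assms by (induction w arbitrary: F F' g\<^sub>0) (auto intro!: derivative_eq_intros)

text \<open>Since \<open>h [] = 0\<close>, the right side of the equation at \<open>w\<close>
  involves the solution only at shorter words. The system is triangular: by induction the difference
  at \<open>w\<close> has derivative 0, and it starts at 0.\<close>

lemma gap_conv_flow_unique:
  fixes X Y :: "complex \<Rightarrow> 'a list \<Rightarrow> complex"
  assumes X: "\<And>s w. ((\<lambda>s. X s w) has_field_derivative gap_conv h (X s) (X s) w) (at s)"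
    and Y: "\<And>s w. ((\<lambda>s. Y s w) has_field_derivative gap_conv h (Y s) (Y s) w) (at s)"
    and "h [] = 0" and init: "X 0 = Y 0"
  shows "X s w = Y s w"
proof (induction w arbitrary: s rule: length_induct)
  case (1 w)
  have "((\<lambda>s. X s w - Y s w) has_field_derivative 0) (at s within UNIV)" for s
  proof -
    have "gap_conv h (X s) (X s) w = gap_conv h (Y s) (Y s) w"
      using 1 \<open>h [] = 0\<close> by (intro gap_conv_cong_less) auto
    then show ?thesis using DERIV_diff[OF X[of w s] Y[of w s]] by simp
  qed
  then have "\<exists>c. \<forall>s\<in>UNIV. X s w - Y s w = c"
    by (intro has_field_derivative_zero_constant) auto
  then have "X s w - Y s w = X 0 w - Y 0 w" by auto
  then show ?case by (simp add: init)
qed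

text \<open>A partition of a nonempty set has a block, hence a factor 0. This provides the initial
  value of the flow.\<close>

lemma moment_zero: "multiplicative \<kappa> \<Longrightarrow> moment \<kappa> (\<lambda>u. 0) = eps"
proof
  fix w :: "'a list" assume \<kappa>: "multiplicative \<kappa>"
  show "moment \<kappa> (\<lambda>u. 0) w = eps w"
  proof (cases w)
    case (Cons x v)
    have "weight \<kappa> (\<lambda>u. 0) w \<pi> = 0" if "\<pi> \<in> NC (length w)" for \<pi>
    proof -
      have \<pi>: "\<pi> \<in> nc_partitions {1..length w}" using that by (simp add: NC_eq_nc_partitions)
      then have "1 \<in> \<Union>\<pi>" using Cons by (auto simp: nc_partitions_def partition_on_def)
      moreover have "finite \<pi>" using nc_partitions_finite[OF \<pi>] by simp
      ultimately show ?thesis by (auto simp: weight_def part_eval_def)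
    qed
    then show ?thesis using Cons by (simp add: moment_def)
  qed (simp add: moment_Nil \<kappa>)
qed

lemma monotone_inverse:
  fixes h :: "'a list \<Rightarrow> complex"
  shows "gap_conv (moment recip h) (moment recip (\<lambda>u. - h u)) (moment recip (\<lambda>u. - h u)) = eps"
proof
  fix w :: "'a list"
  define M where "M s = moment recip (\<lambda>u. s * h u)" for s
  define h\<^sub>0 where "h\<^sub>0 = (\<lambda>u. if u = [] then 0 else h u)"
  have M_deriv: "((\<lambda>s. M s w) has_field_derivative gap_conv h\<^sub>0 (M s) (M s) w) (at s)" for s w
    unfolding M_def h\<^sub>0_def by (rule moment_recip_scale_deriv)
  have M0: "M 0 = eps" by (simp add: M_def moment_zero multiplicative_recip)
  \<comment> \<open>By associativity the left side solves the flow equation, as the shifted right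
    side does, and both equal \<open>M (- 1)\<close> at \<open>s = 0\<close>. The case
    \<open>s = 1\<close> is the claim.\<close>
  have "gap_conv (M s) (M (- 1)) (M (- 1)) w = M (s + - 1) w" for s w
  proof (rule gap_conv_flow_unique[where h = h\<^sub>0 and X = "\<lambda>s. gap_conv (M s) (M (- 1)) (M (- 1))"
        and Y = "\<lambda>s. M (s + - 1)"])
    fix s w
    have "gap_conv (gap_conv h\<^sub>0 (M s) (M s)) (M (- 1)) (M (- 1)) w
        = gap_conv h\<^sub>0 (gap_conv (M s) (M (- 1)) (M (- 1))) (gap_conv (M s) (M (- 1)) (M (- 1))) w"
      by (rule gap_conv_assoc)
    then show "((\<lambda>s. gap_conv (M s) (M (- 1)) (M (- 1)) w) has_field_derivative
        gap_conv h\<^sub>0 (gap_conv (M s) (M (- 1)) (M (- 1))) (gap_conv (M s) (M (- 1)) (M (- 1))) w) (at s)"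
      using gap_conv_deriv[of M "gap_conv h\<^sub>0 (M s) (M s)" s, OF M_deriv] by metis
    show "((\<lambda>s. M (s + - 1) w) has_field_derivative gap_conv h\<^sub>0 (M (s + - 1)) (M (s + - 1)) w) (at s)"
      using M_deriv[where s = "s + - 1" and w = w] unfolding DERIV_shift .
  qed (auto simp: h\<^sub>0_def M0)
  from this[of 1 w] show "gap_conv (moment recip h) (moment recip (\<lambda>u. - h u)) (moment recip (\<lambda>u. - h u)) w
      = eps w"
    by (simp add: M0) (simp add: M_def)
qed

section \<open>Infinitesimal cumulants\<close>

definition kronecker_one :: "nat \<Rightarrow> complex" where
  "kronecker_one x = (if x = 1 then 1 else 0)"

lemma multiplicative_kronecker_one: "multiplicative kronecker_one"
  by (simp add: multiplicative_def kronecker_one_def)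

lemma multiplicative_one: "multiplicative (\<lambda>_. 1)"
  by (simp add: multiplicative_def)

text \<open>A product of natural numbers is 1 only if each factor is. A point of the hull of
  \<open>V\<close> outside \<open>V\<close> belongs to another block, which the absence of crossings
  confines to that hull; so N(V) = 1 exactly when \<open>V\<close> fills its hull.\<close>

lemma tree_factorial_eq_1_iff_intervals:
  assumes "\<pi> \<in> NC n"
  shows "tree_factorial \<pi> = 1 \<longleftrightarrow> (\<forall>V\<in>\<pi>. \<exists>i j. V = {i..j})"
proof -
  have \<pi>: "\<pi> \<in> nc_partitions {1..n}" using assms by (simp add: NC_eq_nc_partitions)
  note fin = nc_partitions_finite[OF \<pi> finite_atLeastAtMost]
  note blk = nc_partitions_finite_block[OF \<pi> finite_atLeastAtMost] nc_partitions_block(2)[OF \<pi>]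
  have iff: "nested_blocks \<pi> V = 1 \<longleftrightarrow> V = {Min V..Max V}" if V: "V \<in> \<pi>" for V
  proof
    assume 1: "nested_blocks \<pi> V = 1"
    have "V \<subseteq> {Min V..Max V}" using blk[OF V] by auto
    obtain U where U: "{W \<in> \<pi>. W \<subseteq> {Min V..Max V}} = {U}"
      using 1 by (auto simp: nested_blocks_def card_1_singleton_iff)
    have eqV: "W = V" if "W \<in> \<pi>" "W \<subseteq> {Min V..Max V}" for W
    proof -
      have "W \<in> {U}" "V \<in> {U}"
        unfolding U[symmetric] using that V \<open>V \<subseteq> _\<close> by auto
      then show ?thesis by simp
    qed
    show "V = {Min V..Max V}"
    proof (rule equalityI[OF \<open>V \<subseteq> _\<close>], rule subsetI, rule ccontr)
      fix x assume x: "x \<in> {Min V..Max V}" "x \<notin> V"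
      have mm: "Min V \<in> V" "Max V \<in> V" using blk[OF V] by auto
      then have "Min V < x" "x < Max V" using x by (auto simp: order.order_iff_strict)
      have "x \<in> {1..n}" using x mm nc_partitions_block(1)[OF \<pi> V] by auto
      then have "x \<in> \<Union>\<pi>" using \<pi> by (auto simp: nc_partitions_def partition_on_def)
      then obtain W where W: "W \<in> \<pi>" "x \<in> W" by auto
      have "W \<noteq> V" using W x by auto
      have "y \<in> {Min V..Max V}" if "y \<in> W" for y
      proof (rule ccontr)
        assume "y \<notin> {Min V..Max V}"
        then consider "y < Min V" | "Max V < y" by force
        then show False
        proof cases
          case 1
          then show False
            using noncrossingD[of \<pi> W V y "Min V" x "Max V"] \<pi> V W mm that \<open>Min V < x\<close> \<open>x < Max V\<close> \<open>W \<noteq> V\<close>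
            by (simp add: nc_partitions_def)
        next
          case 2
          then show False
            using noncrossingD[of \<pi> V W "Min V" x "Max V" y] \<pi> V W mm that \<open>Min V < x\<close> \<open>x < Max V\<close> \<open>W \<noteq> V\<close>
            by (simp add: nc_partitions_def)
        qed
      qed
      then show False using eqV[OF W(1)] \<open>W \<noteq> V\<close> by blast
    qed
  next
    assume eq: "V = {Min V..Max V}"
    have "{W \<in> \<pi>. W \<subseteq> {Min V..Max V}} = {V}"
    proof (intro equalityI subsetI)
      fix W assume "W \<in> {W \<in> \<pi>. W \<subseteq> {Min V..Max V}}"
      then have W: "W \<in> \<pi>" "W \<subseteq> V" using eq by auto
      moreover obtain x where "x \<in> W" using blk(2)[OF W(1)] by auto
      ultimately show "W \<in> {V}" using nc_partitions_same_block[OF \<pi> W(1) V, of x] by auto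
    qed (use V eq in auto)
    then show "nested_blocks \<pi> V = 1" by (simp add: nested_blocks_def)
  qed
  have "tree_factorial \<pi> = 1 \<longleftrightarrow> (\<forall>V\<in>\<pi>. nested_blocks \<pi> V = 1)"
    unfolding tree_factorial_def
  proof
    assume 1: "(\<Prod>V\<in>\<pi>. nested_blocks \<pi> V) = 1"
    show "\<forall>V\<in>\<pi>. nested_blocks \<pi> V = 1"
    proof
      fix V assume "V \<in> \<pi>"
      with fin have "nested_blocks \<pi> V dvd (\<Prod>V\<in>\<pi>. nested_blocks \<pi> V)" by (rule dvd_prodI)
      then show "nested_blocks \<pi> V = 1" unfolding 1 nat_dvd_1_iff_1 .
    qed
  qed (rule prod.neutral)
  also have "\<dots> \<longleftrightarrow> (\<forall>V\<in>\<pi>. \<exists>i j. V = {i..j})"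
  proof (intro ball_cong refl)
    fix V assume V: "V \<in> \<pi>"
    have hull: "V = {Min V..Max V}" if "V = {i..j}" for i j
    proof -
      have "i \<le> j" using that blk(2)[OF V] by simp
      then have "Min {i..j} = i" "Max {i..j} = j" by (auto intro: Min_eqI Max_eqI)
      then show ?thesis using that by simp
    qed
    show "nested_blocks \<pi> V = 1 \<longleftrightarrow> (\<exists>i j. V = {i..j})"
      unfolding iff[OF V]
    proof
      assume "\<exists>i j. V = {i..j}"
      then obtain i j where "V = {i..j}" by (elim exE)
      then show "V = {Min V..Max V}" by (rule hull)
    qed (intro exI)
  qed
  finally show ?thesis .
qed

lemma noncrossing_intervals:
  assumes "disjoint \<pi>" "\<forall>V\<in>\<pi>. \<exists>i j. V = {i..j::nat}"
  shows "noncrossing \<pi>"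
proof (rule noncrossingI)
  fix V W a b c d
  assume *: "V \<in> \<pi>" "W \<in> \<pi>" "a \<in> V" "b \<in> W" "c \<in> V" "d \<in> W" "a < b" "b < c" "c < d"
  obtain i j where "V = {i..j}" using assms(2) * by blast
  then have "b \<in> V" using * by auto
  then show "V = W" using * assms(1) unfolding disjoint_def by blast
qed

lemma interval_partitions_eq: "interval_partitions n = {\<pi> \<in> NC n. tree_factorial \<pi> = 1}"
proof -
  have "\<pi> \<in> interval_partitions n \<longleftrightarrow> \<pi> \<in> NC n \<and> (\<forall>V\<in>\<pi>. \<exists>i j. V = {i..j})" for \<pi>
    using noncrossing_intervals[of \<pi>]
    by (simp only: interval_partitions_def NC_def partitions_def partition_on_def mem_Collect_eq) argo
  then have "\<pi> \<in> interval_partitions n \<longleftrightarrow> \<pi> \<in> NC n \<and> tree_factorial \<pi> = 1" for \<pi>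
    using tree_factorial_eq_1_iff_intervals[of \<pi> n] by (simp only: cong: conj_cong)
  then show ?thesis by (intro set_eqI) (simp only: mem_Collect_eq)
qed

lemma finite_NC: "finite (NC n)"
  by (simp add: NC_eq_nc_partitions finite_nc_partitions)

lemma sum_interval_partitions:
  "(\<Sum>\<pi>\<in>interval_partitions n. F \<pi>) = (\<Sum>\<pi>\<in>NC n. kronecker_one (tree_factorial \<pi>) * F \<pi>)"
proof -
  have "(\<Sum>\<pi>\<in>interval_partitions n. F \<pi>) = (\<Sum>\<pi>\<in>NC n. if tree_factorial \<pi> = 1 then F \<pi> else 0)"
    unfolding interval_partitions_eq by (rule sum.inter_filter[OF finite_NC])
  also have "\<dots> = (\<Sum>\<pi>\<in>NC n. kronecker_one (tree_factorial \<pi>) * F \<pi>)"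
    by (intro sum.cong) (simp_all add: kronecker_one_def)
  finally show ?thesis .
qed

lemma one_block_NC:
  assumes "n \<ge> 1"
  shows "{{1..n}} \<in> NC n" "tree_factorial {{1..n}} = 1"
proof -
  have "{{1..n}} \<in> interval_partitions n"
    using assms by (auto simp: interval_partitions_def partitions_def partition_on_def)
  then show "{{1..n}} \<in> NC n" "tree_factorial {{1..n}} = 1"
    by (auto simp: interval_partitions_eq)
qed

lemma NC_whole_block:
  assumes "\<pi> \<in> NC n" "{1..n} \<in> \<pi>"
  shows "\<pi> = {{1..n}}"
proof -
  have \<pi>: "\<pi> \<in> nc_partitions {1..n}" using assms by (simp add: NC_eq_nc_partitions)
  have "W = {1..n}" if W: "W \<in> \<pi>" for W
  proof -
    obtain x where "x \<in> W" using nc_partitions_block(2)[OF \<pi> W] by auto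
    then show ?thesis
      using nc_partitions_same_block[OF \<pi> W assms(2), of x] nc_partitions_block(1)[OF \<pi> W] by auto
  qed
  then show ?thesis using assms(2) by blast
qed

lemma restrict_args_all: "restrict_args as {1..length as} = as"
  using restrict_args_drop[of as 0] by simp

lemma part_eval_one_block: "part_eval f {{1..length as}} as = f as"
  using restrict_args_all[of as] by (simp add: part_eval_def)

text \<open>Only interval partitions have nonzero weight, and an interval block containing both ends
  is the whole set.\<close>

lemma irr_moment_kronecker_one:
  assumes "w \<noteq> []"
  shows "irr_moment kronecker_one f w = f w"
proof -
  let ?n = "length w"
  have n: "?n \<ge> 1" using assms by (simp add: Suc_leI)
  have "{{1..?n}} \<in> NC_irr ?n" using one_block_NC[OF n] n by (auto simp: NC_irr_def)
  moreover have "finite (NC_irr ?n)" using finite_NC by (simp add: NC_irr_def)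
  moreover have "weight kronecker_one f w \<pi> = 0" if "\<pi> \<in> NC_irr ?n - {{{1..?n}}}" for \<pi>
  proof (rule ccontr)
    assume "weight kronecker_one f w \<pi> \<noteq> 0"
    then have 1: "tree_factorial \<pi> = 1" by (auto simp: weight_def kronecker_one_def split: if_splits)
    from that obtain V where V: "V \<in> \<pi>" "1 \<in> V" "?n \<in> V" "\<pi> \<in> NC ?n" by (auto simp: NC_irr_def)
    then obtain i j where "V = {i..j}" using 1 tree_factorial_eq_1_iff_intervals by blast
    moreover have "V \<subseteq> {1..?n}"
      using V nc_partitions_block(1) by (auto simp: NC_eq_nc_partitions)
    ultimately have "V = {1..?n}" using V by auto
    then show False using NC_whole_block[OF V(4)] V that by auto
  qed
  ultimately have "irr_moment kronecker_one f w = weight kronecker_one f w {{1..?n}}"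
    unfolding irr_moment_def by (subst sum.remove) (auto intro: sum.neutral)
  then show ?thesis
    using one_block_NC(2)[OF n] by (simp add: weight_def kronecker_one_def part_eval_one_block del: One_nat_def)
qed

lemma moment_kronecker_one_Cons:
  "moment kronecker_one f (x # w) = prefix_conv (\<lambda>u. f (x # u)) (moment kronecker_one f) w"
  by (simp add: moment_Cons_irr_moment[OF multiplicative_kronecker_one] irr_moment_kronecker_one)

text \<open>Both sides satisfy the same prefix recursion with value 1 at the empty word.\<close>

lemma moment_kronecker_one_irr_moment:
  assumes "multiplicative \<kappa>"
  shows "moment kronecker_one (irr_moment \<kappa> f) = moment \<kappa> f"
  by (rule prefix_conv_determined[where b = "irr_moment \<kappa> f"])
    (simp_all add: moment_Nil assms multiplicative_kronecker_one moment_kronecker_one_Cons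
      moment_Cons_irr_moment)

lemma free_boolean_moment_inverse:
  "gap_conv (moment (\<lambda>_. 1) r) (moment kronecker_one (\<lambda>u. - r u)) (moment kronecker_one (\<lambda>u. - r u)) = eps"
  by (rule free_boolean_inverse[where r = r])
    (simp_all add: moment_Nil multiplicative_one multiplicative_kronecker_one moment_Cons_free
      moment_kronecker_one_Cons)

text \<open>The two moment functionals are a left and a right inverse of the moments of \<open>-f\<close>.\<close>

lemma moment_free_alternating_irr_moment:
  assumes \<kappa>: "multiplicative \<kappa>"
    and inv: "gap_conv (moment \<kappa> (\<lambda>u. - f u)) (moment \<mu> f) (moment \<mu> f) = eps"
  shows "moment (\<lambda>_. 1) (\<lambda>u. - irr_moment \<kappa> (\<lambda>u. - f u) u) = moment \<mu> f"
proof (rule gap_conv_inverse_unique)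
  let ?b = "irr_moment \<kappa> (\<lambda>u. - f u)"
  have "moment kronecker_one ?b = moment \<kappa> (\<lambda>u. - f u)"
    by (rule moment_kronecker_one_irr_moment[OF \<kappa>])
  then show "gap_conv (moment (\<lambda>_. 1) (\<lambda>u. - ?b u)) (moment \<kappa> (\<lambda>u. - f u)) (moment \<kappa> (\<lambda>u. - f u)) = eps"
    using free_boolean_moment_inverse[of "\<lambda>u. - ?b u"] by simp
qed (rule inv)

lemma moment_free_alternating_boolean:
  "moment (\<lambda>_. 1) (\<lambda>u. - irr_moment (\<lambda>_. 1) (\<lambda>u. - b u) u) = moment kronecker_one b"
  by (rule moment_free_alternating_irr_moment[OF multiplicative_one])
    (use free_boolean_moment_inverse[of "\<lambda>u. - b u"] in simp)

lemma moment_free_alternating_monotone: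
  "moment (\<lambda>_. 1) (\<lambda>u. - irr_moment recip (\<lambda>u. - h u) u) = moment recip h"
  by (rule moment_free_alternating_irr_moment[OF multiplicative_recip])
    (use monotone_inverse[of "\<lambda>u. - h u"] in simp)

section \<open>Differentiating the moment formulas\<close>

definition moment_deriv ::
    "(nat \<Rightarrow> complex) \<Rightarrow> ('a list \<Rightarrow> complex) \<Rightarrow> ('a list \<Rightarrow> complex) \<Rightarrow> 'a list \<Rightarrow> complex" where
  "moment_deriv \<kappa> f f' as = (\<Sum>\<pi>\<in>NC (length as). \<kappa> (tree_factorial \<pi>) * part_deriv f f' \<pi> as)"

definition irr_moment_deriv ::
    "(nat \<Rightarrow> complex) \<Rightarrow> ('a list \<Rightarrow> complex) \<Rightarrow> ('a list \<Rightarrow> complex) \<Rightarrow> 'a list \<Rightarrow> complex" where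
  "irr_moment_deriv \<kappa> f f' as = (\<Sum>\<pi>\<in>NC_irr (length as). \<kappa> (tree_factorial \<pi>) * part_deriv f f' \<pi> as)"

text \<open>\<open>part_deriv\<close> is what the product rule gives for the product over the
  blocks.\<close>

lemma weight_has_derivative:
  fixes F :: "complex \<Rightarrow> 'a list \<Rightarrow> complex"
  assumes "\<And>u. ((\<lambda>t. F t u) has_field_derivative F' u) (at z)"
  shows "((\<lambda>t. weight \<kappa> (F t) as \<pi>) has_field_derivative
    \<kappa> (tree_factorial \<pi>) * part_deriv (F z) F' \<pi> as) (at z)"
proof -
  have "((\<lambda>t. part_eval (F t) \<pi> as) has_field_derivative part_deriv (F z) F' \<pi> as) (at z)"
    unfolding part_eval_def part_deriv_def by (intro has_field_derivative_prod assms)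
  then show ?thesis unfolding weight_def by (rule DERIV_cmult)
qed

lemma moment_has_derivative:
  fixes F :: "complex \<Rightarrow> 'a list \<Rightarrow> complex"
  assumes "\<And>u. ((\<lambda>t. F t u) has_field_derivative F' u) (at z)"
  shows "((\<lambda>t. moment \<kappa> (F t) as) has_field_derivative moment_deriv \<kappa> (F z) F' as) (at z)"
  unfolding moment_def moment_deriv_def by (intro DERIV_sum weight_has_derivative assms)

lemma irr_moment_has_derivative:
  fixes F :: "complex \<Rightarrow> 'a list \<Rightarrow> complex"
  assumes "\<And>u. ((\<lambda>t. F t u) has_field_derivative F' u) (at z)"
  shows "((\<lambda>t. irr_moment \<kappa> (F t) as) has_field_derivative irr_moment_deriv \<kappa> (F z) F' as) (at z)"
  unfolding irr_moment_def irr_moment_deriv_def by (intro DERIV_sum weight_has_derivative assms)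

lemma part_deriv_one_block: "part_deriv f f' {{1..length as}} as = f' as"
  using restrict_args_all[of as] by (simp add: part_deriv_def)

lemma restrict_args_nonempty:
  assumes "\<pi> \<in> NC n" "V \<in> \<pi>"
  shows "restrict_args as V \<noteq> []"
proof -
  have \<pi>: "\<pi> \<in> nc_partitions {1..n}" using assms by (simp add: NC_eq_nc_partitions)
  then have "card V > 0"
    using nc_partitions_block(2)[OF \<pi>] nc_partitions_finite_block[OF \<pi>] assms by (simp add: card_gt_0_iff)
  then show ?thesis
    using length_restrict_args[of V as] nc_partitions_finite_block[OF \<pi> _ assms(2)] by auto
qed

lemma length_restrict_args_less:
  assumes "\<pi> \<in> NC n" "\<pi> \<noteq> {{1..n}}" "V \<in> \<pi>"
  shows "length (restrict_args as V) < n"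
proof -
  have \<pi>: "\<pi> \<in> nc_partitions {1..n}" using assms by (simp add: NC_eq_nc_partitions)
  have "V \<noteq> {1..n}" using NC_whole_block assms by blast
  then have "V \<subset> {1..n}" using nc_partitions_block(1)[OF \<pi> assms(3)] by blast
  then have "card V < card {1..n}" by (intro psubset_card_mono) simp_all
  then show ?thesis
    using length_restrict_args[of V as] nc_partitions_finite_block[OF \<pi> _ assms(3)] by simp
qed

text \<open>The one-block partition contributes the cumulant itself, all others only cumulants of shorter
  words.\<close>

lemma cumulants_determined:
  assumes "\<kappa> 1 = 1" and "\<And>w. w \<noteq> [] \<Longrightarrow> moment \<kappa> f w = moment \<kappa> g w" and "w \<noteq> []"
  shows "f w = g w"
  using \<open>w \<noteq> []\<close>
proof (induction w rule: length_induct)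
  case (1 w)
  let ?n = "length w"
  have n: "?n \<ge> 1" using 1 by (simp add: Suc_leI)
  have split: "moment \<kappa> k w = k w + (\<Sum>\<pi>\<in>NC ?n - {{{1..?n}}}. weight \<kappa> k w \<pi>)" for k
    unfolding moment_def sum.remove[OF finite_NC one_block_NC(1)[OF n]] weight_def
      one_block_NC(2)[OF n] part_eval_one_block by (simp add: assms(1) del: One_nat_def)
  have "(\<Sum>\<pi>\<in>NC ?n - {{{1..?n}}}. weight \<kappa> f w \<pi>) = (\<Sum>\<pi>\<in>NC ?n - {{{1..?n}}}. weight \<kappa> g w \<pi>)"
  proof (rule sum.cong)
    fix \<pi> assume "\<pi> \<in> NC ?n - {{{1..?n}}}"
    then have \<pi>: "\<pi> \<in> NC ?n" "\<pi> \<noteq> {{1..?n}}" by simp_all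
    have "f (restrict_args w V) = g (restrict_args w V)" if "V \<in> \<pi>" for V
      using 1(1) length_restrict_args_less[OF \<pi> that, of w] restrict_args_nonempty[OF \<pi>(1) that, of w]
      by simp
    then show "weight \<kappa> f w \<pi> = weight \<kappa> g w \<pi>" by (simp add: weight_def part_eval_def)
  qed simp
  moreover have "moment \<kappa> f w = moment \<kappa> g w" using 1(2) by (rule assms(2))
  ultimately show ?case unfolding split by simp
qed

text \<open>Blocks are nonempty, so the families are never evaluated at the empty word, where the
  moment-cumulant formulas leave them free.\<close>

lemma moment_deriv_cong:
  assumes "\<And>u. u \<noteq> [] \<Longrightarrow> f u = g u"
  shows "moment_deriv \<kappa> f f' w = moment_deriv \<kappa> g f' w"
  unfolding moment_deriv_def
proof (rule sum.cong)
  fix \<pi> assume \<pi>: "\<pi> \<in> NC (length w)"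
  have "f (restrict_args w V) = g (restrict_args w V)" if "V \<in> \<pi>" for V
    by (rule assms[OF restrict_args_nonempty[OF \<pi> that]])
  then show "\<kappa> (tree_factorial \<pi>) * part_deriv f f' \<pi> w = \<kappa> (tree_factorial \<pi>) * part_deriv g f' \<pi> w"
    by (simp add: part_deriv_def)
qed simp

text \<open>Triangularity as in \<open>cumulants_determined\<close>: for fixed \<open>f\<close>, the
  one-block partition contributes \<open>f' w\<close> itself and the others evaluate
  \<open>f'\<close> only at shorter words.\<close>

lemma infinitesimal_cumulants_determined:
  assumes "\<kappa> 1 = 1" and "\<And>w. w \<noteq> [] \<Longrightarrow> moment_deriv \<kappa> f f' w = moment_deriv \<kappa> f g' w" and "w \<noteq> []"
  shows "f' w = g' w"
  using \<open>w \<noteq> []\<close>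
proof (induction w rule: length_induct)
  case (1 w)
  let ?n = "length w"
  let ?W = "\<lambda>k \<pi>. \<kappa> (tree_factorial \<pi>) * part_deriv f k \<pi> w"
  have n: "?n \<ge> 1" using 1 by (simp add: Suc_leI)
  have split: "moment_deriv \<kappa> f k w = k w + (\<Sum>\<pi>\<in>NC ?n - {{{1..?n}}}. ?W k \<pi>)" for k
    unfolding moment_deriv_def sum.remove[OF finite_NC one_block_NC(1)[OF n]]
      one_block_NC(2)[OF n] part_deriv_one_block by (simp add: assms(1) del: One_nat_def)
  have "(\<Sum>\<pi>\<in>NC ?n - {{{1..?n}}}. ?W f' \<pi>) = (\<Sum>\<pi>\<in>NC ?n - {{{1..?n}}}. ?W g' \<pi>)"
  proof (rule sum.cong)
    fix \<pi> assume "\<pi> \<in> NC ?n - {{{1..?n}}}"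
    then have \<pi>: "\<pi> \<in> NC ?n" "\<pi> \<noteq> {{1..?n}}" by simp_all
    have "f' (restrict_args w V) = g' (restrict_args w V)" if "V \<in> \<pi>" for V
      using 1(1) length_restrict_args_less[OF \<pi> that, of w] restrict_args_nonempty[OF \<pi>(1) that, of w]
      by simp
    then show "?W f' \<pi> = ?W g' \<pi>" by (simp add: part_deriv_def)
  qed simp
  moreover have "moment_deriv \<kappa> f f' w = moment_deriv \<kappa> f g' w" using 1(2) by (rule assms(2))
  ultimately show ?case unfolding split by simp
qed

text \<open>The identity \<open>id\<close> says how the \<open>\<kappa>\<close>-cumulants arise from
  a family whose \<open>\<nu>\<close>-moments are given. Applying it along the line f + t f' and
  differentiating at t = 0 yields the formula for the infinitesimal cumulants. The sign
  \<open>c\<close> is 1 or -1 in the applications.\<close>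

lemma infinitesimal_transfer:
  fixes f f' g g' :: "'a list \<Rightarrow> complex"
  assumes id: "\<And>f. moment \<kappa> (\<lambda>u. c * irr_moment \<mu> (\<lambda>u. c * f u) u) = moment \<nu> (f :: 'a list \<Rightarrow> complex)"
    and \<kappa>: "\<kappa> 1 = 1"
    and moment: "\<And>w. w \<noteq> [] \<Longrightarrow> moment \<kappa> g w = moment \<nu> f w"
    and deriv: "\<And>w. w \<noteq> [] \<Longrightarrow> moment_deriv \<kappa> g g' w = moment_deriv \<nu> f f' w"
    and w: "w \<noteq> []"
  shows "g' w = c * irr_moment_deriv \<mu> (\<lambda>u. c * f u) (\<lambda>u. c * f' u) w"
proof -
  \<comment> \<open>\<open>F t\<close> is the family whose \<open>\<kappa>\<close>-moments are the
    \<open>\<nu>\<close>-moments of f + t f'; \<open>F'\<close> is its derivative at 0.\<close>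
  define F where "F t u = c * irr_moment \<mu> (\<lambda>u. c * (f u + t * f' u)) u" for t u
  define F' where "F' u = c * irr_moment_deriv \<mu> (\<lambda>u. c * f u) (\<lambda>u. c * f' u) u" for u
  have "((\<lambda>t. c * (f u + t * f' u)) has_field_derivative c * f' u) (at 0)" for u
    by (auto intro!: derivative_eq_intros)
  from irr_moment_has_derivative[of "\<lambda>t u. c * (f u + t * f' u)", OF this]
  have F_deriv: "((\<lambda>t. F t u) has_field_derivative F' u) (at 0)" for u
    unfolding F_def F'_def by (auto intro!: DERIV_cmult)
  have "((\<lambda>t. f u + t * f' u) has_field_derivative f' u) (at 0)" for u
    by (auto intro!: derivative_eq_intros)
  from moment_has_derivative[of "\<lambda>t u. f u + t * f' u", OF this, of \<nu>]
  have "((\<lambda>t. moment \<kappa> (F t) v) has_field_derivative moment_deriv \<nu> f f' v) (at 0)" for v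
    unfolding F_def id by simp
  \<comment> \<open>By \<open>id\<close> the same function of t has been differentiated in two
    ways.\<close>
  then have FF': "moment_deriv \<nu> f f' v = moment_deriv \<kappa> (F 0) F' v" for v
    using moment_has_derivative[OF F_deriv] by (rule DERIV_unique)
  have g: "g u = F 0 u" if "u \<noteq> []" for u
    using \<kappa> _ that by (rule cumulants_determined) (simp add: F_def id moment)
  have "g' w = F' w"
    using \<kappa> _ w
  proof (rule infinitesimal_cumulants_determined)
    show "moment_deriv \<kappa> g g' v = moment_deriv \<kappa> g F' v" if "v \<noteq> []" for v
      using deriv[OF that] FF'[of v] moment_deriv_cong[OF g, where f' = F'] by simp
  qed
  then show ?thesis by (simp add: F'_def)
qed

lemma part_deriv_uminus:
  assumes "finite \<pi>"
  shows "part_deriv (\<lambda>u. - f u) (\<lambda>u. - f' u) \<pi> as = (- 1) ^ card \<pi> * part_deriv f f' \<pi> as"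
proof -
  have "- f' (restrict_args as V) * (\<Prod>W\<in>\<pi> - {V}. - f (restrict_args as W))
      = (- 1) ^ card \<pi> * (f' (restrict_args as V) * (\<Prod>W\<in>\<pi> - {V}. f (restrict_args as W)))"
    if "V \<in> \<pi>" for V
  proof -
    have "(- 1 :: complex) ^ card \<pi> = - ((- 1) ^ card (\<pi> - {V}))"
      unfolding card.remove[OF assms that] power_Suc by (rule mult_minus1)
    then show ?thesis unfolding prod_uminus by (simp del: card_Diff_singleton)
  qed
  then show ?thesis by (simp add: part_deriv_def sum_distrib_left)
qed

text \<open>Each block contributes a sign, the differentiated one included; with the outer sign this
  makes \<open>card \<pi> - 1\<close> signs up to an even number.\<close>

lemma irr_moment_deriv_alternating:
  "- irr_moment_deriv \<kappa> (\<lambda>u. - f u) (\<lambda>u. - f' u) as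
    = (\<Sum>\<pi>\<in>NC_irr (length as). (- 1) ^ (card \<pi> - 1) * \<kappa> (tree_factorial \<pi>) * part_deriv f f' \<pi> as)"
  unfolding irr_moment_deriv_def sum_negf[symmetric]
proof (rule sum.cong)
  fix \<pi> assume "\<pi> \<in> NC_irr (length as)"
  then have \<pi>: "\<pi> \<in> nc_partitions {1..length as}" and ne: "\<pi> \<noteq> {}"
    by (auto simp: NC_irr_def NC_eq_nc_partitions)
  have fin: "finite \<pi>" using nc_partitions_finite[OF \<pi>] by simp
  then obtain k where "card \<pi> = Suc k" using ne by (metis card_gt_0_iff gr0_implies_Suc)
  then have "(- 1 :: complex) ^ card \<pi> = - ((- 1) ^ (card \<pi> - 1))" by simp
  then show "- (\<kappa> (tree_factorial \<pi>) * part_deriv (\<lambda>u. - f u) (\<lambda>u. - f' u) \<pi> as)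
      = (- 1) ^ (card \<pi> - 1) * \<kappa> (tree_factorial \<pi>) * part_deriv f f' \<pi> as"
    unfolding part_deriv_uminus[OF fin] by simp
qed simp

theorem theorem1p1:
  fixes scale :: "complex \<Rightarrow> 'a::ring_1 \<Rightarrow> 'a"
    and \<phi> \<phi>' :: "'a \<Rightarrow> complex"
    and r b h r' b' h' :: "'a list \<Rightarrow> complex"
    and n :: nat and as :: "'a list"
  assumes "infinitesimal_ncps scale \<phi> \<phi>'"
    and "free_cumulants scale \<phi> r"
    and "boolean_cumulants scale \<phi> b"
    and "monotone_cumulants scale \<phi> h"
    and "inf_free_cumulants scale \<phi>' r r'"
    and "inf_boolean_cumulants scale \<phi>' b b'"
    and "inf_monotone_cumulants scale \<phi>' h h'"
    and "n \<ge> 1"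
    and "length as = n"
  shows "b' as = (\<Sum>\<pi>\<in>NC_irr n. part_deriv r r' \<pi> as)
    \<and> r' as = (\<Sum>\<pi>\<in>NC_irr n. (-1) ^ (card \<pi> - 1) * part_deriv b b' \<pi> as)
    \<and> b' as = (\<Sum>\<pi>\<in>NC_irr n. 1 / of_nat (tree_factorial \<pi>) * part_deriv h h' \<pi> as)
    \<and> r' as = (\<Sum>\<pi>\<in>NC_irr n.
          (-1) ^ (card \<pi> - 1) / of_nat (tree_factorial \<pi>) * part_deriv h h' \<pi> as)"
proof -
  have len: "length w \<ge> 1" if "w \<noteq> []" for w :: "'a list" using that by (simp add: Suc_leI)
  have moments: "moment (\<lambda>_. 1) r w = \<phi> (prod_list w)"
      "moment kronecker_one b w = \<phi> (prod_list w)"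
      "moment recip h w = \<phi> (prod_list w)"
      "moment_deriv (\<lambda>_. 1) r r' w = \<phi>' (prod_list w)"
      "moment_deriv kronecker_one b b' w = \<phi>' (prod_list w)"
      "moment_deriv recip h h' w = \<phi>' (prod_list w)" if "w \<noteq> []" for w
    using assms(2-7) len[OF that]
    by (simp_all add: free_cumulants_def boolean_cumulants_def monotone_cumulants_def
        inf_free_cumulants_def inf_boolean_cumulants_def inf_monotone_cumulants_def
        moment_def moment_deriv_def weight_def recip_def sum_interval_partitions)
  have as: "as \<noteq> []" using assms(8,9) by auto
  \<comment> \<open>In each transfer \<open>\<kappa>\<close> is the kind of cumulant sought and
    \<open>\<nu>\<close> the kind given. The weight in the irreducible sum is constant for free and
    Boolean input and \<open>recip\<close> for monotone input; \<open>c\<close> is 1 for Boolean and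
    -1 for free output.\<close>
  have "b' as = 1 * irr_moment_deriv (\<lambda>_. 1) (\<lambda>u. 1 * r u) (\<lambda>u. 1 * r' u) as"
    by (rule infinitesimal_transfer[where \<kappa> = kronecker_one and \<nu> = "\<lambda>_. 1" and g = b])
      (simp_all add: moment_kronecker_one_irr_moment multiplicative_one moments as kronecker_one_def)
  moreover have "b' as = 1 * irr_moment_deriv recip (\<lambda>u. 1 * h u) (\<lambda>u. 1 * h' u) as"
    by (rule infinitesimal_transfer[where \<kappa> = kronecker_one and \<nu> = recip and g = b])
      (simp_all add: moment_kronecker_one_irr_moment multiplicative_recip moments as kronecker_one_def)
  moreover have "r' as = - 1 * irr_moment_deriv (\<lambda>_. 1) (\<lambda>u. - 1 * b u) (\<lambda>u. - 1 * b' u) as"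
    by (rule infinitesimal_transfer[where \<kappa> = "\<lambda>_. 1" and \<nu> = kronecker_one and g = r])
      (simp_all add: moment_free_alternating_boolean moments as)
  moreover have "r' as = - 1 * irr_moment_deriv recip (\<lambda>u. - 1 * h u) (\<lambda>u. - 1 * h' u) as"
    by (rule infinitesimal_transfer[where \<kappa> = "\<lambda>_. 1" and \<nu> = recip and g = r])
      (simp_all add: moment_free_alternating_monotone moments as)
  ultimately show ?thesis
    using assms(9) irr_moment_deriv_alternating[of "\<lambda>_. 1" b b' as]
      irr_moment_deriv_alternating[of recip h h' as]
    by (simp add: irr_moment_deriv_def recip_def)
qed

end
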